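(* Let $\sigma>0$ and $p>6$. For each $n\ge 2$ let $X=X^{(n)}=(X_{ij})$ be an $n\times n$ symmetric Wigner matrix constructed from independent random variables with zero mean, variance $\sigma^2$ and finite $p$-th moment, and let $L=L_X=(L_{ij})$ be its Laplacian matrix. Suppose there exists $c>0$ such that $$\sigma\sqrt{(n-1)\log n}\le c\,\max_{1\le i\le n} L_{ii}\qquad\text{with high probability}.$$ Then for all $\epsilon>0$, with $K=c\sqrt{2+\epsilon}>0$, $$\lambda_{\max}(L)\le K\left(1+\frac{1}{\sqrt{n-1}}\right)\max_{1\le i\le n}L_{ii}\qquad\text{with high probability}.$$
   Context: For an $n\times n$ symmetric matrix $X=(X_{ij})$, the Laplacian matrix of $X$ is $L=L_X=D_X-X$, where $D_X$ is the diagonal matrix with $(D_X)_{ii}=\sum_{j=1}^n X_{ij}$. Thus $L_{ij}=-X_{ij}$ for $i\ne j$ and $L_{ii}=\sum_{j\neq i}X_{ij}$ (the diagonal of $X$ plays no role). $\lambda_{\max}(L)$ denotes the largest eigenvalue of $L$. Here a symmetric Wigner matrix is a real symmetric random matrix whose off-diagonal entries $\{X_{ij}:1\le i<j\le n\}$ are independent and identically distributed, with a common law that does not depend on $n$ and that has the stated mean, variance and moment. A sequence of events $\mathcal C_n$ occurs with high probability if for every $\eta>0$ there exists $n_0\in\mathbb{N}$ such that $\mathbb{P}(\mathcal C_n)\ge 1-\eta$ for all $n>n_0$. *)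

theory Defs
  imports
    "HOL-Probability.Probability"
    "Jordan_Normal_Form.Spectral_Radius"
begin

definition laplacian :: "real mat \<Rightarrow> real mat" where
  "laplacian X =
     mat_diag (dim_row X) (\<lambda>i. \<Sum>j<dim_col X. X $$ (i, j)) - X"

text \<open>Over the reals, the spectrum consists of the real eigenvalues. It is finite, and for the
  symmetric matrices of positive dimension considered here it is nonempty and contains every
  eigenvalue.\<close>

definition lambda_max :: "real mat \<Rightarrow> real" where
  "lambda_max A = Max (spectrum A)"

definition max_diag :: "real mat \<Rightarrow> real" where
  "max_diag A = (MAX i\<in>{..<dim_row A}. A $$ (i, i))"

text \<open>The law of the off-diagonal entries is \<open>\<mu>\<close>. Nothing is assumed about the diagonal entries
  beyond measurability.\<close>

definition wigner_matrix ::
  "nat \<Rightarrow> real measure \<Rightarrow> 'a measure \<Rightarrow> ('a \<Rightarrow> real mat) \<Rightarrow> bool" where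
  "wigner_matrix n \<mu> M X \<longleftrightarrow>
     prob_space M \<and>
     (\<forall>\<omega>\<in>space M. X \<omega> \<in> carrier_mat n n \<and> transpose_mat (X \<omega>) = X \<omega>) \<and>
     (\<forall>i<n. \<forall>j<n. (\<lambda>\<omega>. X \<omega> $$ (i, j)) \<in> borel_measurable M) \<and>
     prob_space.indep_vars M (\<lambda>_. borel) (\<lambda>(i, j) \<omega>. X \<omega> $$ (i, j)) {(i, j). i < j \<and> j < n} \<and>
     (\<forall>i j. i < j \<longrightarrow> j < n \<longrightarrow> distr M borel (\<lambda>\<omega>. X \<omega> $$ (i, j)) = \<mu>)"

text \<open>The probability space may depend on \<open>n\<close>. A non-measurable set has measure 0, so a sequence
  satisfying this is eventually a sequence of events.\<close>

definition with_high_probability ::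
  "(nat \<Rightarrow> 'a measure) \<Rightarrow> (nat \<Rightarrow> 'a \<Rightarrow> bool) \<Rightarrow> bool" where
  "with_high_probability M C \<longleftrightarrow>
     (\<forall>\<eta>>0. \<exists>n0. \<forall>n>n0. measure (M n) {\<omega> \<in> space (M n). C n \<omega>} \<ge> 1 - \<eta>)"

end

theory Submission
  imports Defs "HOL-Real_Asymp.Real_Asymp"
begin

text \<open>Since \<open>L = D - X\<close>, the largest eigenvalue is at most the maximal row sum plus the norm of \<open>X\<close>.
  After truncating the entries at \<open>n\<^sup>1\<^sup>/\<^sup>3\<close>, which changes nothing with high probability because
  \<open>p > 6\<close>, and recentring, a Chernoff bound shows that the row sums do not exceed
  \<open>sqrt (2 + \<epsilon> / 2) * \<sigma> * sqrt (n * ln n)\<close>, and the moment method with powers of order \<open>ln n\<close> shows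
  that the norm is \<open>O(sqrt n)\<close>. The factor \<open>1 + 1 / sqrt (n - 1)\<close> merely turns \<open>sqrt (n - 1)\<close> into
  something larger than \<open>sqrt n\<close>.\<close>

section \<open>Quadratic forms and the largest eigenvalue\<close>

text \<open>Row sums live on the scale \<open>sqrt (n * ln n)\<close>, so any bound
  \<open>C * sqrt n\<close> for the norm is of lower order and the moment method may waste constant
  factors: no Catalan numbers, only a bound on the choices at each step. The constant 2 comes from
  the union bound over \<open>n\<close> rows: the Chernoff exponent \<open>a^2 / 2 * ln n\<close>
  has to exceed \<open>ln n\<close>. The obstacle is that beating the dimension takes a power of
  order \<open>ln n\<close>, while the entries are bounded only by
  \<open>2 * n powr (1 / 3)\<close>, so high multiplicities are expensive. A walk is therefore
  revealed step by step. Against the typical price of order \<open>sqrt n\<close>, a cheap step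
  saves a factor of order \<open>n powr (- (1 / 6))\<close>, up to logarithms, and this saving must
  pay for all the choices that the step opens later. Fewer than \<open>n^2\<close> entries exceed
  the truncation level with probability of order \<open>n powr (- p / 3)\<close> each, whence
  \<open>p > 6\<close>. Recentring shifts all entries by a common \<open>m\<close>, which moves the
  quadratic form of the Laplacian by at most \<open>n * |m|\<close> on unit vectors, and this stays
  bounded.\<close>

definition mvec :: "nat \<Rightarrow> (nat \<Rightarrow> nat \<Rightarrow> real) \<Rightarrow> (nat \<Rightarrow> real) \<Rightarrow> nat \<Rightarrow> real" where
  "mvec n Y x i = (\<Sum>j<n. Y i j * x j)"

definition ip :: "nat \<Rightarrow> (nat \<Rightarrow> real) \<Rightarrow> (nat \<Rightarrow> real) \<Rightarrow> real" where
  "ip n x y = (\<Sum>i<n. x i * y i)"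

definition basis :: "nat \<Rightarrow> nat \<Rightarrow> real" where
  "basis i j = (if j = i then 1 else 0)"

lemma ip_self_nonneg: "0 \<le> ip n x x"
  unfolding ip_def by (intro sum_nonneg) simp

lemma ip_self_eq_0_iff: "ip n x x = 0 \<longleftrightarrow> (\<forall>i<n. x i = 0)"
  unfolding ip_def by (subst sum_nonneg_eq_0_iff) auto

lemma ip_commute: "ip n x y = ip n y x"
  unfolding ip_def by (simp add: mult.commute)

lemma ip_Cauchy_Schwarz: "(ip n x y)\<^sup>2 \<le> ip n x x * ip n y y"
  using Cauchy_Schwarz_ineq_sum[of x y "{..<n}"]
  unfolding ip_def by (simp add: power2_eq_square)

lemma ip_mvec:
  assumes "\<And>i j. Y i j = Y j i"
  shows "ip n (mvec n Y x) y = ip n x (mvec n Y y)"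
proof -
  have "ip n (mvec n Y x) y = (\<Sum>i<n. \<Sum>j<n. Y i j * x j * y i)"
    unfolding ip_def mvec_def by (simp add: sum_distrib_right)
  also have "\<dots> = (\<Sum>j<n. \<Sum>i<n. Y i j * x j * y i)"
    by (rule sum.swap)
  also have "\<dots> = (\<Sum>j<n. \<Sum>i<n. x j * (Y j i * y i))"
  proof (intro sum.cong refl)
    fix i j show "Y i j * x j * y i = x j * (Y j i * y i)"
      using assms[of i j] by simp
  qed
  also have "\<dots> = ip n x (mvec n Y y)"
    unfolding ip_def mvec_def by (simp add: sum_distrib_left)
  finally show ?thesis .
qed

section \<open>Bounding a symmetric form by traces of even powers\<close>

lemma ip_mvec_pow:
  assumes "\<And>i j. Y i j = Y j i"
  shows "ip n ((mvec n Y ^^ a) x) ((mvec n Y ^^ b) y) = ip n x ((mvec n Y ^^ (a + b)) y)"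
proof (induction a arbitrary: b)
  case (Suc a)
  have "ip n ((mvec n Y ^^ Suc a) x) ((mvec n Y ^^ b) y)
      = ip n ((mvec n Y ^^ a) x) ((mvec n Y ^^ Suc b) y)"
    by (simp add: ip_mvec[OF assms])
  then show ?case using Suc[of "Suc b"] by simp
qed simp

text \<open>Cauchy-Schwarz and symmetry give \<open>(a m)^2 <= a 0 * a (2 * m)\<close>; repeated
  doubling compares \<open>(a 1 / a 0) ^ (2 ^ l)\<close> with \<open>a (2 ^ l) / a 0\<close>.
  Doubling is the reason why later exponents are powers of two.\<close>

lemma mvec_pow_log_convex:
  assumes sym: "\<And>i j. Y i j = Y j i"
    and a: "\<And>m. a m = ip n ((mvec n Y ^^ m) x) ((mvec n Y ^^ m) x)"
  shows "a 1 ^ (2 ^ l) * a 0 \<le> a 0 ^ (2 ^ l) * a (2 ^ l)"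
proof (induction l)
  case (Suc l)
  have a0: "0 \<le> a m" for m unfolding a by (rule ip_self_nonneg)
  have sq: "(a m)\<^sup>2 \<le> a 0 * a (2 * m)" for m
  proof -
    have "a m = ip n x ((mvec n Y ^^ (m + m)) x)"
      unfolding a by (rule ip_mvec_pow[OF sym])
    then show ?thesis
      using ip_Cauchy_Schwarz[of n x "(mvec n Y ^^ (m + m)) x"] by (simp add: a mult_2)
  qed
  \<comment> \<open>The extra factor \<open>a 0\<close> makes the left side the square of the left
    side of the induction hypothesis. It is cancelled at the end, where \<open>a 0 = 0\<close> is
    trivial.\<close>
  have "a 0 * (a 1 ^ (2 ^ Suc l) * a 0) = (a 1 ^ (2 ^ l) * a 0)\<^sup>2"
    by (simp add: power_mult[symmetric] power2_eq_square mult.commute power_mult_distrib algebra_simps power_even_eq)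
  also have "\<dots> \<le> (a 0 ^ (2 ^ l) * a (2 ^ l))\<^sup>2"
    using Suc a0 by (intro power_mono) auto
  also have "\<dots> = a 0 ^ (2 ^ Suc l) * (a (2 ^ l))\<^sup>2"
    by (simp add: power_mult_distrib power_mult[symmetric] mult.commute)
  also have "\<dots> \<le> a 0 ^ (2 ^ Suc l) * (a 0 * a (2 ^ Suc l))"
    using sq[of "2 ^ l"] a0 by (intro mult_left_mono) auto
  finally have "a 0 * (a 1 ^ (2 ^ Suc l) * a 0) \<le> a 0 * (a 0 ^ (2 ^ Suc l) * a (2 ^ Suc l))"
    by (simp add: mult_ac)
  then show ?case
    using a0[of 0] by (cases "a 0 = 0") (auto simp: mult_le_cancel_left a0)
qed simp

definition pow_trace :: "nat \<Rightarrow> (nat \<Rightarrow> nat \<Rightarrow> real) \<Rightarrow> nat \<Rightarrow> real" where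
  "pow_trace n Y m = (\<Sum>i<n. (mvec n Y ^^ m) (basis i) i)"

lemma mvec_pow_basis_expansion:
  "i < n \<Longrightarrow> (mvec n Y ^^ m) x i = (\<Sum>j<n. x j * (mvec n Y ^^ m) (basis j) i)"
proof (induction m arbitrary: i)
  case 0
  have "(\<Sum>j<n. x j * basis j i) = (\<Sum>j<n. if j = i then x j else 0)"
    by (intro sum.cong) (auto simp: basis_def)
  with 0 show ?case by simp
next
  case (Suc m)
  have "(mvec n Y ^^ Suc m) x i = (\<Sum>k<n. Y i k * (\<Sum>j<n. x j * (mvec n Y ^^ m) (basis j) k))"
    using Suc.IH by (simp add: mvec_def[of n Y "(mvec n Y ^^ m) x"])
  also have "\<dots> = (\<Sum>j<n. \<Sum>k<n. Y i k * (x j * (mvec n Y ^^ m) (basis j) k))"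
    by (subst sum.swap) (simp add: sum_distrib_left)
  also have "\<dots> = (\<Sum>j<n. x j * (mvec n Y ^^ Suc m) (basis j) i)"
    by (simp add: mvec_def[of n Y "(mvec n Y ^^ m) (basis j)" i for j] sum_distrib_left mult_ac)
  finally show ?case .
qed

lemma ip_mvec_pow_basis:
  assumes sym: "\<And>i j. Y i j = Y j i" and "j < n"
  shows "ip n ((mvec n Y ^^ m) (basis j)) ((mvec n Y ^^ m) (basis j)) = (mvec n Y ^^ (2 * m)) (basis j) j"
proof -
  have "ip n ((mvec n Y ^^ m) (basis j)) ((mvec n Y ^^ m) (basis j))
      = (\<Sum>i<n. basis j i * (mvec n Y ^^ (2 * m)) (basis j) i)"
    unfolding ip_mvec_pow[OF sym] mult_2 by (simp add: ip_def)
  also have "\<dots> = (\<Sum>i<n. if i = j then (mvec n Y ^^ (2 * m)) (basis j) i else 0)"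
    by (intro sum.cong) (auto simp: basis_def)
  finally show ?thesis using \<open>j < n\<close> by simp
qed

text \<open>The operator norm of \<open>Y^m\<close> is at most its Frobenius norm, whose square is
  the trace of \<open>Y^(2 m)\<close> by symmetry.\<close>

lemma ip_mvec_pow_le_pow_trace:
  assumes sym: "\<And>i j. Y i j = Y j i"
  shows "ip n ((mvec n Y ^^ m) x) ((mvec n Y ^^ m) x) \<le> ip n x x * pow_trace n Y (2 * m)"
proof -
  let ?P = "\<lambda>j. (mvec n Y ^^ m) (basis j)"
  have "ip n ((mvec n Y ^^ m) x) ((mvec n Y ^^ m) x)
      = (\<Sum>i<n. (\<Sum>j<n. x j * ?P j i)\<^sup>2)"
    unfolding ip_def by (intro sum.cong refl) (simp add: mvec_pow_basis_expansion[where x = x] power2_eq_square)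
  also have "\<dots> \<le> (\<Sum>i<n. (\<Sum>j<n. (x j)\<^sup>2) * (\<Sum>j<n. (?P j i)\<^sup>2))"
    by (intro sum_mono Cauchy_Schwarz_ineq_sum)
  also have "\<dots> = (\<Sum>j<n. (x j)\<^sup>2) * (\<Sum>i<n. \<Sum>j<n. (?P j i)\<^sup>2)"
    by (simp add: sum_distrib_left)
  also have "\<dots> = ip n x x * (\<Sum>j<n. ip n (?P j) (?P j))"
    unfolding ip_def by (subst sum.swap) (simp add: power2_eq_square)
  also have "(\<Sum>j<n. ip n (?P j) (?P j)) = pow_trace n Y (2 * m)"
    unfolding pow_trace_def by (intro sum.cong refl ip_mvec_pow_basis[OF sym]) simp
  finally show ?thesis .
qed

text \<open>Stands in for the spectral theorem: log-convexity and a \<open>k\<close>-th root turn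
  the trace of one high even power into a bound for \<open>Y x\<close>, without diagonalising. The
  trace exceeds the top eigenvalue's share by a factor of at most \<open>n\<close>, which the root
  makes harmless once \<open>k\<close> is of order \<open>ln n\<close>.\<close>

lemma abs_quadratic_form_le_of_pow_trace:
  assumes sym: "\<And>i j. Y i j = Y j i" and k: "k = 2 ^ l" and R: "0 \<le> R"
    and tr: "pow_trace n Y (2 * k) \<le> R ^ (2 * k)"
  shows "\<bar>ip n x (mvec n Y x)\<bar> \<le> R * ip n x x"
proof (cases "ip n x x = 0")
  case True
  then show ?thesis using ip_Cauchy_Schwarz[of n x "mvec n Y x"] by simp
next
  case False
  let ?a0 = "ip n x x" and ?a1 = "ip n (mvec n Y x) (mvec n Y x)"
  have a0: "?a0 > 0" using False ip_self_nonneg[of n x] by linarith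
  have "?a1 ^ k * ?a0 \<le> ?a0 ^ k * ip n ((mvec n Y ^^ k) x) ((mvec n Y ^^ k) x)"
    using mvec_pow_log_convex[OF sym refl, where l = l and n = n and x = x] by (simp add: k)
  also have "\<dots> \<le> ?a0 ^ k * (?a0 * R ^ (2 * k))"
    using order_trans[OF ip_mvec_pow_le_pow_trace[OF sym, where n = n and x = x and m = k] mult_left_mono[OF tr]] a0
    by (intro mult_left_mono) auto
  finally have "?a1 ^ k \<le> (?a0 * R\<^sup>2) ^ k"
    using a0 unfolding power_mult by (simp only: power_mult_distrib) (simp add: mult_ac)
  then have "?a1 \<le> ?a0 * R\<^sup>2"
    using power_mono_iff[of ?a1 "?a0 * R\<^sup>2" k] a0 k by (simp add: ip_self_nonneg)
  then have "(ip n x (mvec n Y x))\<^sup>2 \<le> ?a0 * (?a0 * R\<^sup>2)"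
    using a0 by (intro order_trans[OF ip_Cauchy_Schwarz] mult_left_mono) auto
  then have "(ip n x (mvec n Y x))\<^sup>2 \<le> (R * ?a0)\<^sup>2"
    by (simp add: power2_eq_square mult_ac)
  then show ?thesis using R a0 by (simp add: abs_le_square_iff[symmetric])
qed

section \<open>The largest eigenvalue as a maximum of the quadratic form\<close>

lemma quadratic_form_attains_max:
  assumes "n \<ge> 1"
  obtains u where "ip n u u = 1" "\<And>x. ip n x (mvec n Y x) \<le> ip n u (mvec n Y u) * ip n x x"
proof -
  let ?q = "\<lambda>x. ip n x (mvec n Y x)"
  \<comment> \<open>Functions on \<open>nat\<close> carry the product topology, in which the unit
    sphere of \<open>ip n\<close> is not compact, since the coordinates from \<open>n\<close> on are
    free. Pinning these to 0 gives a product of compact sets; they never enter the form.\<close>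
  define K where "K = (\<Pi>\<^sub>E i\<in>UNIV. if i < n then {-1..1} else {0::real})"
  have "compact K"
    unfolding K_def compactin_euclidean_iff[symmetric] euclidean_product_topology[symmetric]
    by (subst compactin_PiE) auto
  moreover have cont: "continuous_on UNIV (\<lambda>x. ip n x x)" "continuous_on UNIV ?q"
    unfolding ip_def mvec_def by (intro continuous_intros continuous_on_product_coordinates)+
  have "closed {x. ip n x x = 1}"
    using closed_Collect_eq[OF cont(1) continuous_on_const[of _ "1::real"]] by simp
  ultimately have "compact (K \<inter> {x. ip n x x = 1})" by (rule compact_Int_closed)
  moreover have "basis 0 \<in> K \<inter> {x. ip n x x = 1}"
  proof -
    have "ip n (basis 0) (basis 0) = (\<Sum>i<n. if i = 0 then 1 else 0)"
      unfolding ip_def by (intro sum.cong) (auto simp: basis_def)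
    then show ?thesis using assms by (auto simp: K_def basis_def)
  qed
  moreover have "continuous_on (K \<inter> {x. ip n x x = 1}) ?q"
    using cont(2) continuous_on_subset by blast
  ultimately obtain u where u: "u \<in> K \<inter> {x. ip n x x = 1}"
    "\<And>y. y \<in> K \<inter> {x. ip n x x = 1} \<Longrightarrow> ?q y \<le> ?q u"
    by (metis (no_types, lifting) continuous_attains_sup empty_iff)
  have "?q x \<le> ?q u * ip n x x" for x
  proof (cases "ip n x x = 0")
    case True
    then have "?q x = 0" using ip_Cauchy_Schwarz[of n x "mvec n Y x"] by simp
    with True show ?thesis by simp
  next
    case False
    define s where "s = sqrt (ip n x x)"
    have s: "s > 0" "s\<^sup>2 = ip n x x"
      using False ip_self_nonneg[of n x] unfolding s_def by auto
    define y where "y i = (if i < n then x i / s else 0)" for i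
    have yy: "ip n y y = 1"
    proof -
      have "ip n y y = ip n x x / s\<^sup>2"
        unfolding ip_def y_def by (simp add: sum_divide_distrib power2_eq_square)
      then show ?thesis using s False by simp
    qed
    have "\<bar>y i\<bar> \<le> 1" if "i < n" for i
    proof -
      have "(y i)\<^sup>2 \<le> ip n y y"
        unfolding ip_def power2_eq_square using that by (intro member_le_sum) auto
      then show ?thesis using yy by (simp add: abs_square_le_1)
    qed
    then have "y i \<in> (if i < n then {-1..1} else {0})" for i
      by (cases "i < n") (auto simp: abs_le_iff minus_le_iff, simp add: y_def)
    then have "y \<in> K" unfolding K_def PiE_UNIV_domain Pi_iff by blast
    then have "?q y \<le> ?q u" using u(2) yy by blast
    moreover have "?q y = ?q x / s\<^sup>2"
      unfolding ip_def mvec_def y_def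
      by (simp add: sum_divide_distrib sum_distrib_left power2_eq_square field_simps)
    moreover have "0 < ip n x x" using s zero_less_power[of s 2] by simp
    ultimately show ?thesis using s by (simp add: divide_le_eq)
  qed
  with u(1) show ?thesis using that by blast
qed

lemma quadratic_form_add_smult:
  assumes "\<And>i j. Y i j = Y j i"
  shows "ip n (\<lambda>i. u i + s * y i) (mvec n Y (\<lambda>i. u i + s * y i))
       = ip n u (mvec n Y u) + 2 * s * ip n y (mvec n Y u) + s\<^sup>2 * ip n y (mvec n Y y)"
proof -
  have "mvec n Y (\<lambda>i. u i + s * y i) = (\<lambda>i. mvec n Y u i + s * mvec n Y y i)"
    unfolding mvec_def by (simp add: algebra_simps sum.distrib sum_distrib_left)
  then have "ip n (\<lambda>i. u i + s * y i) (mvec n Y (\<lambda>i. u i + s * y i))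
      = ip n u (mvec n Y u) + s * ip n u (mvec n Y y) + s * ip n y (mvec n Y u)
        + s\<^sup>2 * ip n y (mvec n Y y)"
    unfolding ip_def by (simp add: algebra_simps sum.distrib sum_distrib_left power2_eq_square)
  moreover have "ip n u (mvec n Y y) = ip n y (mvec n Y u)"
    using ip_mvec[OF assms, where x = u and y = y and n = n] ip_commute[of n "mvec n Y u" y] by simp
  ultimately show ?thesis by simp
qed

text \<open>First-order condition at the maximum. Moving from \<open>u\<close> by \<open>s\<close>
  times the residual \<open>r\<close> of the eigenvalue equation changes the form minus \<mu> times
  the squared norm by \<open>2 * s * ip n r r - s^2 * q\<close>. This cannot be positive, and a
  small \<open>s > 0\<close> then forces \<open>r = 0\<close>.\<close>

lemma maximizer_is_eigenvector:
  assumes sym: "\<And>i j. Y i j = Y j i" and u: "ip n u u = 1"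
    and max: "\<And>x. ip n x (mvec n Y x) \<le> ip n u (mvec n Y u) * ip n x x"
    and "i < n"
  shows "mvec n Y u i = ip n u (mvec n Y u) * u i"
proof -
  define \<mu> where "\<mu> = ip n u (mvec n Y u)"
  define r where "r i = mvec n Y u i - \<mu> * u i" for i
  define q where "q = \<mu> * ip n r r - ip n r (mvec n Y r)"
  have q0: "q \<ge> 0" using max[of r] unfolding q_def \<mu>_def by simp
  have rr: "ip n r r = ip n r (mvec n Y u) - \<mu> * ip n r u"
    unfolding ip_def r_def by (simp add: algebra_simps sum_subtractf sum_distrib_left)
  have key: "2 * s * ip n r r \<le> s\<^sup>2 * q" for s
  proof -
    have "ip n (\<lambda>i. u i + s * r i) (\<lambda>i. u i + s * r i) = 1 + 2 * s * ip n r u + s\<^sup>2 * ip n r r"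
      using u unfolding ip_def by (simp add: algebra_simps sum.distrib sum_distrib_left power2_eq_square)
    then have "\<mu> + 2 * s * ip n r (mvec n Y u) + s\<^sup>2 * ip n r (mvec n Y r)
        \<le> \<mu> * (1 + 2 * s * ip n r u + s\<^sup>2 * ip n r r)"
      using max[of "\<lambda>i. u i + s * r i"] unfolding quadratic_form_add_smult[OF sym] \<mu>_def by simp
    then show ?thesis unfolding q_def rr by (simp add: algebra_simps)
  qed
  have "ip n r r \<le> 0"
  proof (rule ccontr)
    assume "\<not> ip n r r \<le> 0"
    then have pos: "ip n r r > 0" by simp
    \<comment> \<open>Small enough for \<open>s * q <= ip n r r\<close>; the \<open>+ 1\<close>
      covers \<open>q = 0\<close>.\<close>
    define s where "s = ip n r r / (q + 1)"
    have s: "s > 0" using pos q0 unfolding s_def by simp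
    have "s * (2 * ip n r r) \<le> s * (s * q)" using key[of s] by (simp add: power2_eq_square mult_ac)
    then have "2 * ip n r r \<le> s * q" using s by simp
    moreover have "s * q \<le> ip n r r"
      using pos q0 unfolding s_def by (simp add: field_simps)
    ultimately show False using pos by simp
  qed
  then have "ip n r r = 0" using ip_self_nonneg[of n r] by simp
  then have "r i = 0" using \<open>i < n\<close> unfolding ip_self_eq_0_iff by blast
  then show ?thesis unfolding r_def \<mu>_def by simp
qed

text \<open>Trades the eigenvalue for inequalities that are linear in the entries of
  \<open>A\<close>, one for each vector. Both the estimate of \<open>lambda_max\<close> and the
  measurability of the final event rest on this form.\<close>

lemma lambda_max_le_iff:
  assumes A: "A \<in> carrier_mat n n" and sym: "transpose_mat A = A" and n: "n \<ge> 1"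
  shows "lambda_max A \<le> t \<longleftrightarrow> (\<forall>x. ip n x (mvec n (\<lambda>i j. A $$ (i, j)) x) \<le> t * ip n x x)"
proof -
  \<comment> \<open>Entries outside the index range are unspecified; the extension by zero is
    symmetric at all indices, as the lemmas on forms demand.\<close>
  define Y where "Y i j = (if i < n \<and> j < n then A $$ (i, j) else 0)" for i j
  have mv: "mvec n (\<lambda>i j. A $$ (i, j)) x i = mvec n Y x i" if "i < n" for x i
    unfolding mvec_def Y_def using that by simp
  have q: "ip n x (mvec n (\<lambda>i j. A $$ (i, j)) x) = ip n x (mvec n Y x)" for x
    unfolding ip_def by (simp add: mv)
  have symY: "Y i j = Y j i" for i j
    using A arg_cong[OF sym, of "\<lambda>B. B $$ (i, j)"] unfolding Y_def by auto
  have mult: "A *\<^sub>v v = e \<cdot>\<^sub>v v \<longleftrightarrow> (\<forall>i<n. mvec n Y (vec_index v) i = e * vec_index v i)"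
    if v: "v \<in> carrier_vec n" for v e
  proof -
    have "vec_index (A *\<^sub>v v) i = mvec n Y (vec_index v) i" if "i < n" for i
      using mv[OF that, of "vec_index v"] A v that
      by (simp add: mvec_def scalar_prod_def atLeast0LessThan)
    then show ?thesis
      using A v by (auto simp: vec_eq_iff)
  qed
  obtain u where u: "ip n u u = 1"
    and max: "\<And>x. ip n x (mvec n Y x) \<le> ip n u (mvec n Y u) * ip n x x"
    using quadratic_form_attains_max[OF n, of Y] by metis
  define \<mu> where "\<mu> = ip n u (mvec n Y u)"
  have fin: "finite (spectrum A)" by (rule card_finite_spectrum(1)[OF A])
  have "\<mu> \<in> spectrum A"
  proof -
    let ?v = "Matrix.vec n u"
    have "mvec n Y (vec_index ?v) i = \<mu> * vec_index ?v i" if "i < n" for i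
    proof -
      have "mvec n Y (vec_index ?v) i = mvec n Y u i" unfolding mvec_def by simp
      then show ?thesis
        using maximizer_is_eigenvector[OF symY u max that] that by (simp add: \<mu>_def)
    qed
    then have "A *\<^sub>v ?v = \<mu> \<cdot>\<^sub>v ?v" by (subst mult) auto
    moreover have "?v \<noteq> 0\<^sub>v n"
    proof
      assume "?v = 0\<^sub>v n"
      then have "\<forall>i<n. u i = 0" by (metis index_vec index_zero_vec(1))
      then show False using u ip_self_eq_0_iff[of n u] by simp
    qed
    ultimately show ?thesis
      using A unfolding spectrum_def eigenvalue_def eigenvector_def
      by (auto intro!: exI[of _ ?v])
  qed
  moreover have "e \<le> \<mu>" if "e \<in> spectrum A" for e
  proof -
    obtain v where v: "v \<in> carrier_vec n" "v \<noteq> 0\<^sub>v n" "A *\<^sub>v v = e \<cdot>\<^sub>v v"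
      using \<open>e \<in> spectrum A\<close> A unfolding spectrum_def eigenvalue_def eigenvector_def by auto
    have "ip n (vec_index v) (mvec n Y (vec_index v)) = e * ip n (vec_index v) (vec_index v)"
      using v(3) unfolding mult[OF v(1)] ip_def by (simp add: sum_distrib_left mult_ac)
    then have "e * ip n (vec_index v) (vec_index v) \<le> \<mu> * ip n (vec_index v) (vec_index v)"
      using max[of "vec_index v"] unfolding \<mu>_def by simp
    moreover have "ip n (vec_index v) (vec_index v) \<noteq> 0"
      using v(1,2) unfolding ip_self_eq_0_iff by (auto simp: vec_eq_iff)
    ultimately show ?thesis
      using ip_self_nonneg[of n "vec_index v"] by (simp add: mult_le_cancel_right)
  qed
  ultimately have lm: "lambda_max A = \<mu>"
    unfolding lambda_max_def using fin by (intro Max_eqI) auto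
  show ?thesis
  proof
    assume "lambda_max A \<le> t"
    then have "\<mu> * ip n x x \<le> t * ip n x x" for x
      using lm ip_self_nonneg by (intro mult_right_mono) auto
    then show "\<forall>x. ip n x (mvec n (\<lambda>i j. A $$ (i, j)) x) \<le> t * ip n x x"
      using max unfolding q \<mu>_def by (meson order_trans)
  next
    assume "\<forall>x. ip n x (mvec n (\<lambda>i j. A $$ (i, j)) x) \<le> t * ip n x x"
    then have "\<mu> \<le> t * ip n u u" unfolding q \<mu>_def by blast
    then show "lambda_max A \<le> t" using lm u by simp
  qed
qed

section \<open>Counting walks\<close>

text \<open>Walks are stored as lists of vertices with the current vertex at the head.\<close>

fun wmult :: "nat list \<Rightarrow> nat set \<Rightarrow> nat" where
  "wmult (v # u # h) e = (if e = {u, v} then 1 else 0) + wmult (u # h) e"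
| "wmult _ e = 0"

text \<open>A step is cheap if it closes a cycle with a fresh edge or uses an edge for at least the third time.
  Cheap steps cost a negative power of \<open>n\<close> in the moment expansion. Without cheap steps the walk
  traverses a tree twice, and then a second traversal of an edge is forced.\<close>

fun cheap :: "nat list \<Rightarrow> nat" where
  "cheap (v # u # h) = cheap (u # h) +
     (if wmult (u # h) {u, v} = 0 \<and> v \<in> set (u # h) \<or> wmult (u # h) {u, v} \<ge> 2 then 1 else 0)"
| "cheap _ = 0"

definition once :: "nat \<Rightarrow> nat list \<Rightarrow> nat \<Rightarrow> nat set" where
  "once n h x = {v. v < n \<and> wmult h {x, v} = 1}"

lemma finite_once [simp]: "finite (once n h x)"
  unfolding once_def by simp

lemma wmult_eq_0_if_not_visited: "v \<in> e \<Longrightarrow> v \<notin> set h \<Longrightarrow> wmult h e = 0"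
  by (induction h e rule: wmult.induct) auto

text \<open>Bounds the number of ways to make a step that uses an edge for the second time.\<close>

lemma card_once_le:
  assumes "distinct_adj h" "h \<noteq> []" "set h \<subseteq> {..<n}"
  shows "card (once n h (hd h)) \<le> 1 + 2 * cheap h \<and> (\<forall>x. card (once n h x) \<le> 2 + 2 * cheap h)"
  using assms
proof (induction h rule: cheap.induct)
  case (1 v u h)
  define m where "m = wmult (u # h) {u, v}"
  define c where "c = cheap (u # h)"
  have uv: "u \<noteq> v" "u < n" "v < n" using 1 by auto
  \<comment> \<open>Picture for the invariant: without cheap steps, the edges used exactly once form
    the tree path from the start to the current vertex. So the current vertex has at most one of
    them and every other vertex at most two; each cheap step loosens both bounds by 2.\<close>
  have IH: "card (once n (u # h) u) \<le> 1 + 2 * c" "card (once n (u # h) x) \<le> 2 + 2 * c" for x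
    using 1 by (auto simp: c_def)
  have step: "wmult (v # u # h) {x, y} = (if {x, y} = {u, v} then 1 else 0) + wmult (u # h) {x, y}" for x y
    by simp
  have other: "once n (v # u # h) x = once n (u # h) x" if "x \<noteq> u" "x \<noteq> v" for x
    using that unfolding once_def step by (auto simp: doubleton_eq_iff)
  have at_u: "once n (v # u # h) u \<subseteq> insert v (once n (u # h) u)"
    and at_u': "m \<ge> 1 \<Longrightarrow> once n (v # u # h) u \<subseteq> once n (u # h) u"
    using uv unfolding once_def step m_def by (auto simp: doubleton_eq_iff split: if_splits)
  have vu: "{v, u} = {u, v}" by auto
  have at_v: "once n (v # u # h) v \<subseteq> insert u (once n (u # h) v)"
    and at_v': "m \<ge> 1 \<Longrightarrow> once n (v # u # h) v \<subseteq> once n (u # h) v - {u}"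
    using uv unfolding once_def step m_def by (auto simp: doubleton_eq_iff vu split: if_splits)
  have card_u: "card (once n (v # u # h) u) \<le> 2 + 2 * c"
    using card_mono[OF _ at_u] card_insert_le_m1 IH(1)
    by (auto simp: card_insert_if split: if_splits intro: order_trans)
  \<comment> \<open>A new vertex has only the new edge. A second traversal removes \<open>u\<close>
    from the candidates at \<open>v\<close>, turning the bound for ordinary vertices into the one
    for the current vertex. The other two cases are cheap, and the increase by 2 pays for
    them.\<close>
  consider "m = 0" "v \<notin> set (u # h)" | "m = 0" "v \<in> set (u # h)" | "m = 1" | "m \<ge> 2"
    by linarith
  then have card_v: "card (once n (v # u # h) v) \<le> 1 + 2 * cheap (v # u # h)"
  proof cases
    case 1
    have "once n (u # h) v = {}"
      using wmult_eq_0_if_not_visited[OF _ 1(2)] unfolding once_def by auto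
    then have "card (once n (v # u # h) v) \<le> 1"
      using card_mono[OF _ at_v] by simp
    then show ?thesis by simp
  next
    case 2
    have "card (once n (v # u # h) v) \<le> Suc (card (once n (u # h) v))"
      using card_mono[OF _ at_v] by (auto simp: card_insert_if split: if_splits)
    then show ?thesis using IH(2)[of v] 2 by (simp add: m_def c_def)
  next
    case 3
    have "wmult (u # h) {v, u} = 1" using 3 unfolding m_def vu .
    then have "u \<in> once n (u # h) v" using uv unfolding once_def by simp
    then have "card (once n (v # u # h) v) \<le> card (once n (u # h) v) - 1"
      using card_mono[OF _ at_v'] 3 by simp
    then show ?thesis using IH(2)[of v] by (simp add: c_def)
  next
    case 4
    have "once n (v # u # h) v \<subseteq> once n (u # h) v" using at_v' 4 by auto
    then have "card (once n (v # u # h) v) \<le> card (once n (u # h) v)"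
      using card_mono[OF finite_once] by blast
    then show ?thesis using IH(2)[of v] 4 by (simp add: m_def c_def)
  qed
  have "c \<le> cheap (v # u # h)" by (simp add: c_def)
  moreover have "card (once n (v # u # h) x) \<le> 2 + 2 * cheap (v # u # h)" for x
  proof (cases "x = v")
    case True
    then show ?thesis using card_v by simp
  next
    case False
    have "card (once n (v # u # h) x) \<le> 2 + 2 * c"
    proof (cases "x = u")
      case True
      then show ?thesis using card_u by simp
    next
      case False
      then show ?thesis using other[OF False \<open>x \<noteq> v\<close>] IH(2)[of x] by simp
    qed
    then show ?thesis using \<open>c \<le> _\<close> by linarith
  qed
  ultimately show ?case using card_v by simp
qed (auto simp: once_def)

section \<open>Products over edges and the weight of a walk\<close>

definition pairs :: "nat \<Rightarrow> (nat \<times> nat) set" where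
  "pairs n = {(i, j). i < j \<and> j < n}"

lemma finite_pairs [simp]: "finite (pairs n)"
  by (rule finite_subset[of _ "{..<n} \<times> {..<n}"]) (auto simp: pairs_def)

text \<open>A step raises the multiplicity of a single edge, so a single factor changes.
  \<open>f\<close> may depend on the edge because the lemma serves both the deterministic weights
  and the products of matrix entries.\<close>

lemma prod_pairs_Cons:
  fixes f :: "nat \<times> nat \<Rightarrow> nat \<Rightarrow> 'b :: comm_monoid_mult"
  assumes uv: "u \<noteq> v" "u < n" "v < n"
    and m: "m = wmult (u # h) {u, v}"
    and f: "f (min u v, max u v) (Suc m) = g * f (min u v, max u v) m"
  shows "(\<Prod>(i, j)\<in>pairs n. f (i, j) (wmult (v # u # h) {i, j}))
       = g * (\<Prod>(i, j)\<in>pairs n. f (i, j) (wmult (u # h) {i, j}))"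
proof -
  let ?p = "(min u v, max u v)"
  have p: "?p \<in> pairs n" using uv unfolding pairs_def by auto
  have e: "{min u v, max u v} = {u, v}" by (auto simp: min_def max_def)
  have ne: "{i, j} \<noteq> {u, v}" if "(i, j) \<in> pairs n - {?p}" for i j
    using that uv by (auto simp: pairs_def doubleton_eq_iff min_def max_def)
  have rest: "(\<Prod>(i, j)\<in>pairs n - {?p}. f (i, j) (wmult (v # u # h) {i, j}))
      = (\<Prod>(i, j)\<in>pairs n - {?p}. f (i, j) (wmult (u # h) {i, j}))"
  proof (rule prod.cong[OF refl])
    fix p assume "p \<in> pairs n - {?p}"
    then show "(case p of (i, j) \<Rightarrow> f (i, j) (wmult (v # u # h) {i, j}))
        = (case p of (i, j) \<Rightarrow> f (i, j) (wmult (u # h) {i, j}))"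
      using ne[of "fst p" "snd p"] by (cases p) simp
  qed
  show ?thesis
    unfolding prod.remove[OF finite_pairs p]
    by (subst rest) (simp add: e m[symmetric] f mult_ac)
qed

text \<open>With \<open>\<alpha> = \<sigma> / sqrt n\<close> and \<open>\<tau> = \<sigma> * sqrt n\<close>, \<open>edge_weight\<close> dominates the moments of a centred entry
  bounded by \<open>B\<close>. A first moment vanishes, so its weight \<open>\<alpha>\<close> is a free choice; this one makes the sum
  over all fresh vertices cost the same factor \<open>\<tau>\<close> as a second traversal.\<close>

definition edge_weight :: "real \<Rightarrow> real \<Rightarrow> real \<Rightarrow> nat \<Rightarrow> real" where
  "edge_weight \<alpha> \<tau> B m = (if m = 0 then 1 else if m = 1 then \<alpha> else \<alpha> * \<tau> * B ^ (m - 2))"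

text \<open>The ratio of successive edge weights: the price of traversing an edge once more.\<close>

definition step_weight :: "real \<Rightarrow> real \<Rightarrow> real \<Rightarrow> nat \<Rightarrow> real" where
  "step_weight \<alpha> \<tau> B m = (if m = 0 then \<alpha> else if m = 1 then \<tau> else B)"

definition walk_weight :: "nat \<Rightarrow> real \<Rightarrow> real \<Rightarrow> real \<Rightarrow> nat list \<Rightarrow> real" where
  "walk_weight n \<alpha> \<tau> B h = (\<Prod>(i, j)\<in>pairs n. edge_weight \<alpha> \<tau> B (wmult h {i, j}))"

lemma edge_weight_Suc: "edge_weight \<alpha> \<tau> B (Suc m) = step_weight \<alpha> \<tau> B m * edge_weight \<alpha> \<tau> B m"
proof -
  consider "m = 0" | "m = 1" | k where "m = Suc (Suc k)"
    by (metis One_nat_def not0_implies_Suc)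
  then show ?thesis by cases (auto simp: edge_weight_def step_weight_def)
qed

lemma walk_weight_Cons:
  assumes "u \<noteq> v" "u < n" "v < n"
  shows "walk_weight n \<alpha> \<tau> B (v # u # h)
       = step_weight \<alpha> \<tau> B (wmult (u # h) {u, v}) * walk_weight n \<alpha> \<tau> B (u # h)"
  unfolding walk_weight_def
  by (rule prod_pairs_Cons[OF assms refl, where f = "\<lambda>_. edge_weight \<alpha> \<tau> B"]) (rule edge_weight_Suc)

lemma walk_weight_nonneg:
  assumes "\<alpha> \<ge> 0" "\<tau> \<ge> 0" "B \<ge> 0"
  shows "walk_weight n \<alpha> \<tau> B h \<ge> 0"
  unfolding walk_weight_def using assms by (intro prod_nonneg) (auto simp: edge_weight_def)

text \<open>The factor \<open>2 * c + 1\<close> for second traversals is absorbed via \<open>\<theta> * x \<le> exp (\<theta> * x)\<close>, one exponential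
  factor for each of the \<open>m\<close> remaining steps.\<close>

definition walk_bound :: "real \<Rightarrow> real \<Rightarrow> nat \<Rightarrow> nat \<Rightarrow> real" where
  "walk_bound \<tau> \<theta> m c = ((2 / \<theta> + 1) * \<tau>) ^ m * exp (\<theta> * real m * (real c + 1))"

lemma walk_bound_nonneg: "\<tau> > 0 \<Longrightarrow> \<theta> > 0 \<Longrightarrow> walk_bound \<tau> \<theta> m c \<ge> 0"
  unfolding walk_bound_def by (intro mult_nonneg_nonneg zero_le_power) auto

text \<open>The recursion that dictates the shape of \<open>walk_bound\<close>. Of
  \<open>2 * c + 2\<close>, one unit is for fresh vertices and \<open>2 * c + 1\<close> are for
  second traversals; it is at most \<open>2 / \<theta> * exp (\<theta> * (c + 1))\<close>. A cheap
  step has relative price \<rho> and raises \<open>c\<close>, which multiplies the bound by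
  \<open>exp (\<theta> * m)\<close>; the hypothesis on \<rho> cancels exactly that.\<close>

lemma walk_bound_step:
  assumes pos: "\<tau> > 0" "\<theta> > 0"
    and \<rho>: "\<rho> * exp (\<theta> * real m) \<le> 1" "\<rho> \<ge> 0"
  shows "\<tau> * ((2 * real c + 2) * walk_bound \<tau> \<theta> m c + \<rho> * walk_bound \<tau> \<theta> m (c + 1))
       \<le> walk_bound \<tau> \<theta> (Suc m) c"
proof -
  let ?P = "((2 / \<theta> + 1) * \<tau>) ^ m" and ?E = "exp (\<theta> * real m * (real c + 1))"
    and ?e = "exp (\<theta> * (real c + 1))"
  have P: "?P \<ge> 0" using pos by simp
  have "\<theta> * (real c + 1) \<le> ?e" using exp_ge_add_one_self[of "\<theta> * (real c + 1)"] by linarith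
  then have "2 * real c + 2 \<le> 2 / \<theta> * ?e" using pos by (simp add: field_simps)
  then have 1: "(2 * real c + 2) * (?P * ?E) \<le> (2 / \<theta> * ?e) * (?P * ?E)"
    using P by (intro mult_right_mono) auto
  have e1: "?e \<ge> 1" using pos by simp
  have "\<rho> * walk_bound \<tau> \<theta> m (c + 1) = (\<rho> * exp (\<theta> * real m)) * (?P * ?E)"
  proof -
    have "exp (\<theta> * real m * (real (c + 1) + 1)) = exp (\<theta> * real m) * ?E"
      by (simp add: exp_add[symmetric] algebra_simps)
    then show ?thesis unfolding walk_bound_def by simp
  qed
  also have "\<dots> \<le> 1 * (?P * ?E)"
    using P \<rho>(1) by (intro mult_right_mono) auto
  also have "\<dots> \<le> ?e * (?P * ?E)"
    using P e1 by (intro mult_right_mono) auto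
  finally have "(2 * real c + 2) * walk_bound \<tau> \<theta> m c + \<rho> * walk_bound \<tau> \<theta> m (c + 1)
      \<le> (2 / \<theta> + 1) * (?P * (?E * ?e))"
    using 1 unfolding walk_bound_def by (simp add: algebra_simps)
  also have "?E * ?e = exp (\<theta> * real (Suc m) * (real c + 1))"
    by (simp add: exp_add[symmetric] algebra_simps)
  finally show ?thesis
    using pos mult_left_mono[of _ _ \<tau>] unfolding walk_bound_def by (simp add: mult_ac)
qed

text \<open>The next vertices are charged in three groups. Fresh ones cost \<alpha> each, together
  at most \<open>n * \<alpha> = \<tau>\<close>. Second traversals cost \<tau> each, and
  \<open>card_once_le\<close> limits their number. Cheap steps lead to one of at most
  \<open>N\<close> visited vertices and cost \<alpha> or \<open>B\<close>, so
  \<open>\<alpha> + B\<close> covers both kinds.\<close>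

lemma sum_step_weight_le:
  assumes pos: "\<alpha> > 0" "\<tau> > 0" "B \<ge> 0" "\<theta> > 0" and n\<alpha>: "real n * \<alpha> = \<tau>"
    and h: "distinct_adj (u # h)" "set (u # h) \<subseteq> {..<n}"
    and len: "length (u # h) \<le> N" and m: "m \<le> N"
    and \<rho>: "real N * (\<alpha> + B) * exp (\<theta> * real N) \<le> \<tau>"
  shows "(\<Sum>v\<in>{..<n} - {u}. step_weight \<alpha> \<tau> B (wmult (u # h) {u, v}) *
            walk_bound \<tau> \<theta> m (cheap (v # u # h)))
       \<le> walk_bound \<tau> \<theta> (Suc m) (cheap (u # h))"
proof -
  define c where "c = cheap (u # h)"
  let ?F = "walk_bound \<tau> \<theta> m"
  have F: "?F x \<ge> 0" for x using pos by (intro walk_bound_nonneg)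
  have once: "card (once n (u # h) u) \<le> 1 + 2 * c"
    using card_once_le[OF h(1) _ h(2)] by (simp add: c_def)
  define a where "a v = (if v \<in> set (u # h) then (\<alpha> + B) * ?F (c + 1) else 0)" for v
  define b where "b v = (if v \<in> once n (u # h) u then \<tau> * ?F c else 0)" for v
  have pointwise: "step_weight \<alpha> \<tau> B (wmult (u # h) {u, v}) * ?F (cheap (v # u # h))
      \<le> \<alpha> * ?F c + a v + b v" if v: "v \<in> {..<n} - {u}" for v
  proof -
    define k where "k = wmult (u # h) {u, v}"
    have ab: "a v \<ge> 0" "b v \<ge> 0" "\<alpha> * ?F c \<ge> 0" "\<alpha> * ?F (c + 1) \<ge> 0" "B * ?F (c + 1) \<ge> 0"
      using pos F unfolding a_def b_def by auto
    consider "k = 0" "v \<notin> set (u # h)" | "k = 0" "v \<in> set (u # h)" | "k = 1" | "k \<ge> 2"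
      by linarith
    then show ?thesis
    proof cases
      case 1
      then show ?thesis using ab by (simp add: step_weight_def k_def c_def)
    next
      case 2
      have "cheap (v # u # h) = c + 1" using 2 by (simp add: k_def c_def)
      moreover have "a v = (\<alpha> + B) * ?F (c + 1)" unfolding a_def using 2 by (simp only: if_True)
      ultimately show ?thesis
        using 2 ab by (simp add: step_weight_def k_def[symmetric] algebra_simps)
    next
      case 3
      have "cheap (v # u # h) = c" using 3 by (simp add: k_def c_def)
      moreover have "b v = \<tau> * ?F c" using 3 v unfolding b_def once_def k_def by simp
      ultimately show ?thesis
        using 3 ab by (simp add: step_weight_def k_def[symmetric])
    next
      case 4
      have "v \<in> set (u # h)"
        using 4 wmult_eq_0_if_not_visited[of v "{u, v}" "u # h"] unfolding k_def by fastforce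
      then have "a v = (\<alpha> + B) * ?F (c + 1)" unfolding a_def by (simp only: if_True)
      moreover have "cheap (v # u # h) = c + 1" using 4 by (simp add: k_def c_def)
      ultimately show ?thesis
        using 4 ab by (simp add: step_weight_def k_def[symmetric] algebra_simps)
    qed
  qed
  have "(\<Sum>v\<in>{..<n} - {u}. step_weight \<alpha> \<tau> B (wmult (u # h) {u, v}) * ?F (cheap (v # u # h)))
      \<le> (\<Sum>v\<in>{..<n} - {u}. \<alpha> * ?F c + a v + b v)"
    by (intro sum_mono pointwise)
  also have "\<dots> \<le> (\<Sum>v<n. \<alpha> * ?F c + a v + b v)"
    using pos F by (intro sum_mono2) (auto simp: a_def b_def)
  also have "\<dots> = real n * \<alpha> * ?F c + (\<Sum>v<n. a v) + (\<Sum>v<n. b v)"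
    by (simp add: sum.distrib)
  also have "(\<Sum>v<n. a v) \<le> real N * ((\<alpha> + B) * ?F (c + 1))"
  proof -
    have "(\<Sum>v<n. a v) = real (card ({..<n} \<inter> set (u # h))) * ((\<alpha> + B) * ?F (c + 1))"
      unfolding a_def by (subst sum.inter_restrict[symmetric]) auto
    also have "card ({..<n} \<inter> set (u # h)) \<le> card (set (u # h))"
      by (intro card_mono) auto
    also have "card (set (u # h)) \<le> N" using card_length[of "u # h"] len by linarith
    finally show ?thesis using pos F by (simp add: mult_right_mono)
  qed
  also have "(\<Sum>v<n. b v) \<le> (1 + 2 * real c) * (\<tau> * ?F c)"
  proof -
    have "{..<n} \<inter> once n (u # h) u = once n (u # h) u" unfolding once_def by auto
    then have "(\<Sum>v<n. b v) = real (card (once n (u # h) u)) * (\<tau> * ?F c)"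
      unfolding b_def by (subst sum.inter_restrict[symmetric]) auto
    also have "real (card (once n (u # h) u)) \<le> 1 + 2 * real c" using once by linarith
    finally show ?thesis using pos F by (simp add: mult_right_mono)
  qed
  also have "real n * \<alpha> * ?F c + real N * ((\<alpha> + B) * ?F (c + 1)) + (1 + 2 * real c) * (\<tau> * ?F c)
      = \<tau> * ((2 * real c + 2) * ?F c + (real N * (\<alpha> + B) / \<tau>) * ?F (c + 1))"
    using pos unfolding n\<alpha> by (simp add: field_simps)
  also have "\<dots> \<le> walk_bound \<tau> \<theta> (Suc m) c"
  proof (rule walk_bound_step)
    have "real N * (\<alpha> + B) * exp (\<theta> * real m) \<le> real N * (\<alpha> + B) * exp (\<theta> * real N)"
      using pos m by (intro mult_left_mono) auto
    then show "real N * (\<alpha> + B) / \<tau> * exp (\<theta> * real m) \<le> 1"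
      using \<rho> pos by (simp add: field_simps)
  qed (use pos in auto)
  finally show ?thesis by (simp add: c_def)
qed

section \<open>Bounded Wigner matrices\<close>

fun walk_prod :: "(nat \<Rightarrow> nat \<Rightarrow> real) \<Rightarrow> nat list \<Rightarrow> real" where
  "walk_prod Y (v # u # h) = Y u v * walk_prod Y (u # h)"
| "walk_prod Y _ = 1"

text \<open>Collects the factors edge by edge, which is where independence applies.\<close>

lemma walk_prod_eq_prod_pairs:
  assumes "\<And>i j. Y i j = Y j i" "distinct_adj h" "set h \<subseteq> {..<n}"
  shows "walk_prod Y h = (\<Prod>(i, j)\<in>pairs n. Y i j ^ wmult h {i, j})"
  using assms(2,3)
proof (induction h rule: cheap.induct)
  case (1 v u h)
  then have uv: "u \<noteq> v" "u < n" "v < n" by auto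
  have "Y (min u v) (max u v) = Y u v"
    using assms(1)[of u v] by (simp add: min_def max_def)
  then have "(\<Prod>(i, j)\<in>pairs n. Y i j ^ wmult (v # u # h) {i, j})
      = Y u v * (\<Prod>(i, j)\<in>pairs n. Y i j ^ wmult (u # h) {i, j})"
    using prod_pairs_Cons[OF uv refl, where f = "\<lambda>(i, j) m. Y i j ^ m" and g = "Y u v"] by simp
  then show ?case using 1 by simp
qed auto

text \<open>What remains of the matrix after truncating and recentring: the mean is exactly 0, but
  the variance is only bounded by its old value. The zero diagonal excludes loops from the
  walks.\<close>

locale bounded_wigner = prob_space M for M :: "'a measure" +
  fixes n :: nat and Y :: "nat \<Rightarrow> nat \<Rightarrow> 'a \<Rightarrow> real" and \<sigma> B :: real
  assumes n_pos: "n \<ge> 1" and \<sigma>_pos: "\<sigma> > 0" and B_nonneg: "B \<ge> 0"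
    and sym: "Y i j = Y j i"
    and diag: "Y i i \<omega> = 0"
    and meas [measurable]: "Y i j \<in> borel_measurable M"
    and bounded: "\<bar>Y i j \<omega>\<bar> \<le> B"
    and indep: "indep_vars (\<lambda>_. borel) (\<lambda>(i, j). Y i j) (pairs n)"
    and mean: "i < j \<Longrightarrow> j < n \<Longrightarrow> expectation (Y i j) = 0"
    and variance_le: "i < j \<Longrightarrow> j < n \<Longrightarrow> expectation (\<lambda>\<omega>. (Y i j \<omega>)\<^sup>2) \<le> \<sigma>\<^sup>2"
begin

lemma expectation_prod_pairs:
  fixes f :: "nat \<times> nat \<Rightarrow> real \<Rightarrow> real"
  assumes [measurable]: "\<And>p. f p \<in> borel_measurable borel"
    and bdd: "\<And>i j \<omega>. \<bar>f (i, j) (Y i j \<omega>)\<bar> \<le> C"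
  shows "expectation (\<lambda>\<omega>. \<Prod>(i, j)\<in>pairs n. f (i, j) (Y i j \<omega>))
       = (\<Prod>(i, j)\<in>pairs n. expectation (\<lambda>\<omega>. f (i, j) (Y i j \<omega>)))"
proof -
  have "indep_vars (\<lambda>_. borel) (\<lambda>p \<omega>. f p ((case p of (i, j) \<Rightarrow> Y i j) \<omega>)) (pairs n)"
    by (rule indep_vars_compose2[OF indep]) measurable
  then have "indep_vars (\<lambda>_. borel) (\<lambda>p \<omega>. case p of (i, j) \<Rightarrow> f (i, j) (Y i j \<omega>)) (pairs n)"
    by (rule indep_vars_cong[THEN iffD1, rotated -1]) auto
  moreover have "integrable M (\<lambda>\<omega>. case p of (i, j) \<Rightarrow> f (i, j) (Y i j \<omega>))" for p
    using bdd by (cases p) (auto intro!: integrable_const_bound[where B = C])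
  ultimately show ?thesis
    using indep_vars_lebesgue_integral[of "pairs n" "\<lambda>p \<omega>. case p of (i, j) \<Rightarrow> f (i, j) (Y i j \<omega>)"]
    by (simp add: case_prod_beta)
qed

lemma expectation_power_le_edge_weight:
  assumes ij: "i < j" "j < n" and \<alpha>: "\<alpha> \<ge> 0" and \<alpha>\<tau>: "\<alpha> * \<tau> = \<sigma>\<^sup>2"
  shows "\<bar>expectation (\<lambda>\<omega>. Y i j \<omega> ^ m)\<bar> \<le> edge_weight \<alpha> \<tau> B m"
proof -
  consider "m = 0" | "m = 1" | k where "m = Suc (Suc k)"
    by (metis One_nat_def not0_implies_Suc)
  then show ?thesis
  proof cases
    case 1
    then show ?thesis by (simp add: edge_weight_def prob_space)
  next
    case 2
    then show ?thesis using mean[OF ij] \<alpha> by (simp add: edge_weight_def)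
  next
    case 3
    have le: "\<bar>Y i j \<omega> ^ m\<bar> \<le> B ^ k * (Y i j \<omega>)\<^sup>2" for \<omega>
    proof -
      have "\<bar>Y i j \<omega> ^ m\<bar> = \<bar>Y i j \<omega>\<bar> ^ k * (Y i j \<omega>)\<^sup>2"
        unfolding 3 by (simp add: power_abs abs_mult power2_eq_square)
      then show ?thesis
        using bounded by (auto intro!: mult_right_mono power_mono)
    qed
    have int2: "integrable M (\<lambda>\<omega>. (Y i j \<omega>)\<^sup>2)"
    proof (rule integrable_const_bound[where B = "B\<^sup>2"])
      have "(Y i j \<omega>)\<^sup>2 \<le> B\<^sup>2" for \<omega>
        using bounded[of i j \<omega>] B_nonneg by (simp add: abs_le_square_iff[symmetric])
      then show "AE \<omega> in M. norm ((Y i j \<omega>)\<^sup>2) \<le> B\<^sup>2" by simp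
    qed simp
    have "\<bar>expectation (\<lambda>\<omega>. Y i j \<omega> ^ m)\<bar> \<le> expectation (\<lambda>\<omega>. B ^ k * (Y i j \<omega>)\<^sup>2)"
      using le int2 B_nonneg by (intro integral_abs_bound[THEN order_trans] integral_mono_AE') auto
    also have "\<dots> \<le> B ^ k * \<sigma>\<^sup>2"
      using variance_le[OF ij] B_nonneg by (simp add: mult_left_mono)
    finally show ?thesis using 3 \<alpha>\<tau> by (simp add: edge_weight_def mult_ac)
  qed
qed

lemma expectation_walk_prod_le:
  assumes h: "distinct_adj h" "set h \<subseteq> {..<n}" and \<alpha>: "\<alpha> \<ge> 0" and \<alpha>\<tau>: "\<alpha> * \<tau> = \<sigma>\<^sup>2"
  shows "expectation (\<lambda>\<omega>. walk_prod (\<lambda>i j. Y i j \<omega>) h) \<le> walk_weight n \<alpha> \<tau> B h"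
proof -
  let ?k = "\<lambda>p. wmult h {fst p, snd p}"
  define K where "K = Max (?k ` pairs n)"
  define C where "C = (max 1 B) ^ K"
  \<comment> \<open>\<open>expectation_prod_pairs\<close> wants one bound for all index pairs, while
    \<open>K\<close> only controls the exponents on \<open>pairs n\<close>; hence the cut-off to 0
    elsewhere.\<close>
  define k where "k p = (if p \<in> pairs n then ?k p else 0)" for p
  have "expectation (\<lambda>\<omega>. walk_prod (\<lambda>i j. Y i j \<omega>) h)
      = expectation (\<lambda>\<omega>. \<Prod>(i, j)\<in>pairs n. Y i j \<omega> ^ k (i, j))"
  proof (intro Bochner_Integration.integral_cong refl)
    fix \<omega>
    have "walk_prod (\<lambda>i j. Y i j \<omega>) h = (\<Prod>(i, j)\<in>pairs n. Y i j \<omega> ^ wmult h {i, j})"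
      using sym by (intro walk_prod_eq_prod_pairs h) metis
    also have "\<dots> = (\<Prod>(i, j)\<in>pairs n. Y i j \<omega> ^ k (i, j))"
      by (intro prod.cong refl) (auto simp: k_def)
    finally show "walk_prod (\<lambda>i j. Y i j \<omega>) h = (\<Prod>(i, j)\<in>pairs n. Y i j \<omega> ^ k (i, j))" .
  qed
  also have "\<dots> = (\<Prod>(i, j)\<in>pairs n. expectation (\<lambda>\<omega>. Y i j \<omega> ^ k (i, j)))"
  proof (rule expectation_prod_pairs[where f = "\<lambda>p y. y ^ k p" and C = C])
    fix i j \<omega>
    have "k (i, j) \<le> K"
      unfolding k_def K_def by (auto intro!: Max_ge image_eqI[where x = "(i, j)"])
    have "\<bar>Y i j \<omega> ^ k (i, j)\<bar> \<le> (max 1 B) ^ k (i, j)"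
      unfolding power_abs using bounded[of i j \<omega>] by (intro power_mono) auto
    also have "\<dots> \<le> C"
      unfolding C_def using \<open>k (i, j) \<le> K\<close> by (intro power_increasing) auto
    finally show "\<bar>Y i j \<omega> ^ k (i, j)\<bar> \<le> C" .
  qed simp
  also have "\<dots> \<le> \<bar>\<dots>\<bar>" by simp
  also have "\<dots> \<le> walk_weight n \<alpha> \<tau> B h"
    unfolding walk_weight_def abs_prod
    by (intro prod_mono)
       (auto simp: pairs_def k_def intro!: expectation_power_le_edge_weight \<alpha> \<alpha>\<tau>)
  finally show ?thesis .
qed

section \<open>Integrability of polynomial expressions in the entries\<close>

definition bounded_rv :: "('a \<Rightarrow> real) \<Rightarrow> bool" where
  "bounded_rv f \<longleftrightarrow> f \<in> borel_measurable M \<and> (\<exists>C. \<forall>\<omega>. \<bar>f \<omega>\<bar> \<le> C)"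

lemma bounded_rv_integrable: "bounded_rv f \<Longrightarrow> integrable M f"
  unfolding bounded_rv_def by (elim conjE exE, rule integrable_const_bound) auto

lemma bounded_rv_const: "bounded_rv (\<lambda>_. c)"
  unfolding bounded_rv_def by auto

lemma bounded_rv_Y: "bounded_rv (Y i j)"
  unfolding bounded_rv_def using bounded by auto

lemma bounded_rv_mult: "bounded_rv f \<Longrightarrow> bounded_rv g \<Longrightarrow> bounded_rv (\<lambda>\<omega>. f \<omega> * g \<omega>)"
  unfolding bounded_rv_def abs_mult
proof (elim conjE exE, intro conjI)
  fix C D assume "\<forall>\<omega>. \<bar>f \<omega>\<bar> \<le> C" "\<forall>\<omega>. \<bar>g \<omega>\<bar> \<le> D"
  then have "\<bar>f \<omega>\<bar> * \<bar>g \<omega>\<bar> \<le> C * D" for \<omega>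
    by (intro mult_mono) (auto intro: order_trans[OF abs_ge_zero])
  then show "\<exists>C. \<forall>\<omega>. \<bar>f \<omega>\<bar> * \<bar>g \<omega>\<bar> \<le> C" by blast
qed simp

lemma bounded_rv_sum: "finite I \<Longrightarrow> (\<And>i. i \<in> I \<Longrightarrow> bounded_rv (f i)) \<Longrightarrow> bounded_rv (\<lambda>\<omega>. \<Sum>i\<in>I. f i \<omega>)"
proof (induction I rule: finite_induct)
  case (insert a I)
  then have "bounded_rv (f a)" "bounded_rv (\<lambda>\<omega>. \<Sum>i\<in>I. f i \<omega>)" by auto
  then obtain C D where [measurable]: "f a \<in> borel_measurable M" "(\<lambda>\<omega>. \<Sum>i\<in>I. f i \<omega>) \<in> borel_measurable M"
    and CD: "\<And>\<omega>. \<bar>f a \<omega>\<bar> \<le> C" "\<And>\<omega>. \<bar>\<Sum>i\<in>I. f i \<omega>\<bar> \<le> D"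
    unfolding bounded_rv_def by auto
  have "\<bar>f a \<omega> + (\<Sum>i\<in>I. f i \<omega>)\<bar> \<le> C + D" for \<omega>
    using CD[of \<omega>] by linarith
  then show ?case unfolding bounded_rv_def sum.insert[OF insert(1,2)]
    by (intro conjI borel_measurable_add) (auto intro: exI[of _ "C + D"])
qed (simp add: bounded_rv_const)

lemma bounded_rv_mvec_pow: "bounded_rv (\<lambda>\<omega>. (mvec n (\<lambda>i j. Y i j \<omega>) ^^ m) x i)"
  by (induction m arbitrary: i)
     (auto simp: mvec_def[of n _ "(f ^^ k) x" for f k] intro!: bounded_rv_const bounded_rv_sum bounded_rv_mult bounded_rv_Y)

lemma bounded_rv_walk_prod: "bounded_rv (\<lambda>\<omega>. walk_prod (\<lambda>i j. Y i j \<omega>) h)"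
  by (induction h rule: cheap.induct) (auto intro!: bounded_rv_mult bounded_rv_Y bounded_rv_const)

text \<open>Expanding one matrix product at a time extends the walk \<open>u # h\<close>; the walk never needs to close up.\<close>

lemma expectation_walk_mvec_pow_le:
  assumes pos: "\<alpha> > 0" "\<tau> > 0" "\<theta> > 0" and \<alpha>\<tau>: "\<alpha> * \<tau> = \<sigma>\<^sup>2" and n\<alpha>: "real n * \<alpha> = \<tau>"
    and \<rho>: "real N * (\<alpha> + B) * exp (\<theta> * real N) \<le> \<tau>"
    and h: "distinct_adj (u # h)" "set (u # h) \<subseteq> {..<n}"
    and len: "length (u # h) + m \<le> N + 1"
  shows "expectation (\<lambda>\<omega>. walk_prod (\<lambda>i j. Y i j \<omega>) (u # h) *
            (mvec n (\<lambda>i j. Y i j \<omega>) ^^ m) (basis k) u)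
       \<le> walk_weight n \<alpha> \<tau> B (u # h) * walk_bound \<tau> \<theta> m (cheap (u # h))"
  using h len
proof (induction m arbitrary: u h)
  case 0
  have W: "walk_weight n \<alpha> \<tau> B (u # h) \<ge> 0"
    using pos B_nonneg by (intro walk_weight_nonneg) auto
  show ?case
  proof (cases "u = k")
    case True
    then show ?thesis
      using expectation_walk_prod_le[OF 0(1,2) less_imp_le[OF pos(1)] \<alpha>\<tau>]
      by (simp add: basis_def walk_bound_def)
  next
    case False
    then show ?thesis using W by (simp add: basis_def walk_bound_def)
  qed
next
  case (Suc m)
  define Z where "Z v \<omega> = walk_prod (\<lambda>i j. Y i j \<omega>) (v # u # h) *
    (mvec n (\<lambda>i j. Y i j \<omega>) ^^ m) (basis k) v" for v \<omega>
  have W: "walk_weight n \<alpha> \<tau> B (u # h) \<ge> 0"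
    using pos B_nonneg by (intro walk_weight_nonneg) auto
  have u: "u < n" using Suc by simp
  have int: "integrable M (Z v)" for v
    unfolding Z_def by (intro bounded_rv_integrable bounded_rv_mult bounded_rv_walk_prod bounded_rv_mvec_pow)
  have "walk_prod (\<lambda>i j. Y i j \<omega>) (u # h) * (mvec n (\<lambda>i j. Y i j \<omega>) ^^ Suc m) (basis k) u
      = (\<Sum>v\<in>{..<n} - {u}. Z v \<omega>)" for \<omega>
  proof -
    have "walk_prod (\<lambda>i j. Y i j \<omega>) (u # h) * (mvec n (\<lambda>i j. Y i j \<omega>) ^^ Suc m) (basis k) u
        = (\<Sum>v<n. Z v \<omega>)"
      unfolding Z_def by (simp add: mvec_def[of n _ "(f ^^ l) x" for f l x] sum_distrib_left mult_ac)
    \<comment> \<open>The loop \<open>v = u\<close> vanishes with the diagonal, so the extended walk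
      again has distinct neighbours.\<close>
    also have "\<dots> = (\<Sum>v\<in>{..<n} - {u}. Z v \<omega>)"
      by (intro sum.mono_neutral_right) (auto simp: Z_def diag)
    finally show ?thesis .
  qed
  then have "expectation (\<lambda>\<omega>. walk_prod (\<lambda>i j. Y i j \<omega>) (u # h) *
        (mvec n (\<lambda>i j. Y i j \<omega>) ^^ Suc m) (basis k) u)
      = (\<Sum>v\<in>{..<n} - {u}. expectation (Z v))"
    using int by simp
  also have "\<dots> \<le> (\<Sum>v\<in>{..<n} - {u}. walk_weight n \<alpha> \<tau> B (v # u # h) *
      walk_bound \<tau> \<theta> m (cheap (v # u # h)))"
    unfolding Z_def using Suc.prems by (intro sum_mono Suc.IH) auto
  also have "\<dots> = walk_weight n \<alpha> \<tau> B (u # h) * (\<Sum>v\<in>{..<n} - {u}.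
      step_weight \<alpha> \<tau> B (wmult (u # h) {u, v}) * walk_bound \<tau> \<theta> m (cheap (v # u # h)))"
    unfolding sum_distrib_left
  proof (rule sum.cong[OF refl])
    fix v assume "v \<in> {..<n} - {u}"
    then show "walk_weight n \<alpha> \<tau> B (v # u # h) * walk_bound \<tau> \<theta> m (cheap (v # u # h)) =
      walk_weight n \<alpha> \<tau> B (u # h) * (step_weight \<alpha> \<tau> B (wmult (u # h) {u, v}) *
        walk_bound \<tau> \<theta> m (cheap (v # u # h)))"
      using u by (subst walk_weight_Cons) auto
  qed
  also have "\<dots> \<le> walk_weight n \<alpha> \<tau> B (u # h) * walk_bound \<tau> \<theta> (Suc m) (cheap (u # h))"
    using Suc.prems
    by (intro mult_left_mono[OF _ W] sum_step_weight_le[where N = N] pos B_nonneg n\<alpha> \<rho>) auto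
  finally show ?case .
qed

text \<open>Each of the \<open>n\<close> starting points contributes walks of \<open>N\<close> steps
  with no cheap step behind them. The hypothesis says that a cheap step, with its at most
  \<open>N\<close> targets, keeps its advantage over \<tau> even against the largest factor
  \<open>exp (\<theta> * N)\<close>.\<close>

lemma expectation_pow_trace_le:
  assumes \<theta>: "\<theta> > 0"
    and \<rho>: "real N * (1 / real n + B / (\<sigma> * sqrt (real n))) * exp (\<theta> * real N) \<le> 1"
  shows "expectation (\<lambda>\<omega>. pow_trace n (\<lambda>i j. Y i j \<omega>) N)
       \<le> real n * ((2 / \<theta> + 1) * exp \<theta> * \<sigma> * sqrt (real n)) ^ N"
    and "integrable M (\<lambda>\<omega>. pow_trace n (\<lambda>i j. Y i j \<omega>) N)"
proof -
  define \<alpha> where "\<alpha> = \<sigma> / sqrt (real n)"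
  define \<tau> where "\<tau> = \<sigma> * sqrt (real n)"
  have pos: "\<alpha> > 0" "\<tau> > 0" using \<sigma>_pos n_pos by (auto simp: \<alpha>_def \<tau>_def)
  have \<alpha>\<tau>: "\<alpha> * \<tau> = \<sigma>\<^sup>2" using n_pos by (simp add: \<alpha>_def \<tau>_def power2_eq_square)
  have n\<alpha>: "real n * \<alpha> = \<tau>" 
  proof -
    have "real n * \<alpha> = \<sigma> * (real n / sqrt (real n))" by (simp add: \<alpha>_def)
    then show ?thesis by (simp add: \<tau>_def real_div_sqrt)
  qed
  have "\<alpha> + B = (1 / real n + B / (\<sigma> * sqrt (real n))) * \<tau>"
    using n\<alpha> pos n_pos unfolding \<tau>_def[symmetric] by (simp add: field_simps)
  then have \<rho>': "real N * (\<alpha> + B) * exp (\<theta> * real N) \<le> \<tau>"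
    using mult_right_mono[OF \<rho>, of \<tau>] pos by (simp add: mult_ac)
  have int: "integrable M (\<lambda>\<omega>. (mvec n (\<lambda>i j. Y i j \<omega>) ^^ N) (basis i) i)" for i
    by (intro bounded_rv_integrable bounded_rv_mvec_pow)
  then show "integrable M (\<lambda>\<omega>. pow_trace n (\<lambda>i j. Y i j \<omega>) N)"
    unfolding pow_trace_def by simp
  have single: "expectation (\<lambda>\<omega>. (mvec n (\<lambda>i j. Y i j \<omega>) ^^ N) (basis i) i)
      \<le> ((2 / \<theta> + 1) * exp \<theta> * \<sigma> * sqrt (real n)) ^ N" if "i < n" for i
  proof -
    have "expectation (\<lambda>\<omega>. (mvec n (\<lambda>i j. Y i j \<omega>) ^^ N) (basis i) i)
        \<le> walk_weight n \<alpha> \<tau> B [i] * walk_bound \<tau> \<theta> N (cheap [i])"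
      using expectation_walk_mvec_pow_le[OF pos \<theta> \<alpha>\<tau> n\<alpha> \<rho>', of i "[]" N i] that by simp
    also have "walk_weight n \<alpha> \<tau> B [i] = 1"
      unfolding walk_weight_def by (intro prod.neutral) (auto simp: edge_weight_def)
    also have "walk_bound \<tau> \<theta> N (cheap [i]) = ((2 / \<theta> + 1) * exp \<theta> * \<sigma> * sqrt (real n)) ^ N"
      unfolding walk_bound_def \<tau>_def
      by (simp add: power_mult_distrib exp_of_nat2_mult mult_ac)
    finally show ?thesis by simp
  qed
  have "expectation (\<lambda>\<omega>. pow_trace n (\<lambda>i j. Y i j \<omega>) N)
      = (\<Sum>i<n. expectation (\<lambda>\<omega>. (mvec n (\<lambda>i j. Y i j \<omega>) ^^ N) (basis i) i))"
    unfolding pow_trace_def using int by simp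
  also have "\<dots> \<le> (\<Sum>i<n. ((2 / \<theta> + 1) * exp \<theta> * \<sigma> * sqrt (real n)) ^ N)"
    by (intro sum_mono single) auto
  finally show "expectation (\<lambda>\<omega>. pow_trace n (\<lambda>i j. Y i j \<omega>) N)
       \<le> real n * ((2 / \<theta> + 1) * exp \<theta> * \<sigma> * sqrt (real n)) ^ N" by simp
qed

text \<open>A second-order expansion keeps the Gaussian exponent \<open>t^2 * \<sigma>^2 / 2\<close>
  up to a factor that tends to 1 with \<open>t * B\<close>. Hoeffding's lemma would put
  \<open>B^2\<close> in place of the variance and lose the constant 2.\<close>

lemma expectation_exp_le:
  assumes ij: "i < j" "j < n" and t: "t \<ge> 0"
  shows "expectation (\<lambda>\<omega>. exp (t * Y i j \<omega>)) \<le> exp (t\<^sup>2 * \<sigma>\<^sup>2 / 2 * exp (t * B))"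
proof -
  have exp_le: "exp x \<le> 1 + x + x\<^sup>2 / 2 * exp \<bar>x\<bar>" for x :: real
  proof -
    obtain s where s: "\<bar>s\<bar> \<le> \<bar>x\<bar>" "exp x = (\<Sum>m<2. x ^ m / fact m) + exp s / fact 2 * x ^ 2"
      using Maclaurin_exp_le[of x 2] by blast
    have "exp s \<le> exp \<bar>x\<bar>" using s(1) by simp
    then have "x\<^sup>2 / 2 * exp s \<le> x\<^sup>2 / 2 * exp \<bar>x\<bar>" by (intro mult_left_mono) auto
    then show ?thesis using s(2) by (simp add: numeral_2_eq_2 mult_ac)
  qed
  have le: "exp (t * Y i j \<omega>) \<le> 1 + t * Y i j \<omega> + t\<^sup>2 / 2 * exp (t * B) * (Y i j \<omega>)\<^sup>2" for \<omega>
  proof -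
    have "\<bar>t * Y i j \<omega>\<bar> \<le> t * B"
      using bounded t by (simp add: abs_mult mult_left_mono)
    then have "(t * Y i j \<omega>)\<^sup>2 / 2 * exp \<bar>t * Y i j \<omega>\<bar> \<le> (t * Y i j \<omega>)\<^sup>2 / 2 * exp (t * B)"
      by (intro mult_left_mono) auto
    then show ?thesis using exp_le[of "t * Y i j \<omega>"] by (simp add: power_mult_distrib mult_ac)
  qed
  have intY: "integrable M (Y i j)" by (rule bounded_rv_integrable[OF bounded_rv_Y])
  have intY2: "integrable M (\<lambda>\<omega>. (Y i j \<omega>)\<^sup>2)"
    unfolding power2_eq_square by (intro bounded_rv_integrable bounded_rv_mult bounded_rv_Y)
  have "expectation (\<lambda>\<omega>. exp (t * Y i j \<omega>))
      \<le> expectation (\<lambda>\<omega>. 1 + t * Y i j \<omega> + t\<^sup>2 / 2 * exp (t * B) * (Y i j \<omega>)\<^sup>2)"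
    using le order_trans[OF exp_ge_zero le] intY intY2 by (intro integral_mono_AE') auto
  also have "\<dots> = 1 + t\<^sup>2 / 2 * exp (t * B) * expectation (\<lambda>\<omega>. (Y i j \<omega>)\<^sup>2)"
    using intY intY2 mean[OF ij] by (simp add: prob_space)
  also have "\<dots> \<le> 1 + t\<^sup>2 / 2 * exp (t * B) * \<sigma>\<^sup>2"
    using variance_le[OF ij] by (intro add_left_mono mult_left_mono) auto
  also have "\<dots> \<le> exp (t\<^sup>2 / 2 * exp (t * B) * \<sigma>\<^sup>2)" by (rule exp_ge_add_one_self)
  finally show ?thesis by (simp add: mult_ac)
qed

lemma row_sum_tail:
  assumes i: "i < n" and t: "t > 0"
  shows "prob {\<omega> \<in> space M. (\<Sum>j<n. Y i j \<omega>) \<ge> s}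
       \<le> exp (real n * (t\<^sup>2 * \<sigma>\<^sup>2 / 2 * exp (t * B)) - t * s)"
proof -
  \<comment> \<open>Weights that single out row \<open>i\<close>: the exponential of the row sum
    becomes a product over all of \<open>pairs n\<close>, the family known to be
    independent.\<close>
  define a where "a p = (if i \<in> {fst p, snd p} then t else 0)" for p :: "nat \<times> nat"
  define D where "D = t\<^sup>2 * \<sigma>\<^sup>2 / 2 * exp (t * B)"
  have D: "D \<ge> 0" unfolding D_def by simp
  \<comment> \<open>Row \<open>i\<close> read above the diagonal: the entries left of the diagonal
    are replaced by their mirror images.\<close>
  define I where "I = (\<lambda>j. (min i j, max i j)) ` ({..<n} - {i})"
  have inj: "inj_on (\<lambda>j. (min i j, max i j)) ({..<n} - {i})"
    by (rule inj_onI) (auto simp: min_def max_def split: if_splits)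
  have I: "I = {p \<in> pairs n. i \<in> {fst p, snd p}}"
  proof
    show "I \<subseteq> {p \<in> pairs n. i \<in> {fst p, snd p}}"
      using i unfolding I_def pairs_def by (auto simp: min_def max_def split: if_splits)
    show "{p \<in> pairs n. i \<in> {fst p, snd p}} \<subseteq> I"
    proof
      fix p assume "p \<in> {p \<in> pairs n. i \<in> {fst p, snd p}}"
      then obtain k l where kl: "p = (k, l)" "k < l" "l < n" "i = k \<or> i = l"
        by (auto simp: pairs_def)
      then have "p = (\<lambda>j. (min i j, max i j)) (if i = k then l else k)"
        "(if i = k then l else k) \<in> {..<n} - {i}"
        by auto
      then show "p \<in> I" unfolding I_def by blast
    qed
  qed
  have cardI: "card I = n - 1" unfolding I_def using card_image[OF inj] i by simp
  have sumI: "(\<Sum>p\<in>pairs n. a p * y p) = t * (\<Sum>p\<in>I. y p)" for y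
    unfolding I sum_distrib_left a_def
    by (subst sum.inter_filter) (auto intro!: sum.cong)
  have sum_eq: "t * (\<Sum>j<n. Y i j \<omega>) = (\<Sum>(k, l)\<in>pairs n. a (k, l) * Y k l \<omega>)" for \<omega>
  proof -
    have "(\<Sum>j<n. Y i j \<omega>) = (\<Sum>j\<in>{..<n} - {i}. Y i j \<omega>)"
      by (intro sum.mono_neutral_right) (auto simp: diag)
    also have "\<dots> = (\<Sum>j\<in>{..<n} - {i}. Y (min i j) (max i j) \<omega>)"
      using sym[of i] by (intro sum.cong) (auto simp: min_def max_def)
    also have "\<dots> = (\<Sum>p\<in>I. Y (fst p) (snd p) \<omega>)"
      unfolding I_def by (subst sum.reindex[OF inj]) simp
    finally show ?thesis using sumI[of "\<lambda>p. Y (fst p) (snd p) \<omega>"] by (simp add: case_prod_beta)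
  qed
  have exp_eq: "exp (t * (\<Sum>j<n. Y i j \<omega>)) = (\<Prod>(k, l)\<in>pairs n. exp (a (k, l) * Y k l \<omega>))" for \<omega>
    unfolding sum_eq by (simp add: exp_sum case_prod_beta)
  have ab: "\<bar>exp (a (k, l) * Y k l \<omega>)\<bar> \<le> exp (t * B)" for k l \<omega>
  proof -
    have "a (k, l) * Y k l \<omega> \<le> a (k, l) * B"
      using bounded[of k l \<omega>] t by (intro mult_left_mono) (auto simp: a_def)
    also have "\<dots> \<le> t * B" using B_nonneg t by (simp add: a_def)
    finally show ?thesis by simp
  qed
  have "expectation (\<lambda>\<omega>. exp (t * (\<Sum>j<n. Y i j \<omega>)))
      = (\<Prod>(k, l)\<in>pairs n. expectation (\<lambda>\<omega>. exp (a (k, l) * Y k l \<omega>)))"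
    unfolding exp_eq
    by (rule expectation_prod_pairs[where f = "\<lambda>p y. exp (a p * y)" and C = "exp (t * B)"])
       (use ab in auto)
  also have "\<dots> \<le> (\<Prod>p\<in>pairs n. exp (if p \<in> I then D else 0))"
  proof (intro prod_mono)
    fix p assume p: "p \<in> pairs n"
    then obtain k l where kl: "p = (k, l)" "k < l" "l < n" by (auto simp: pairs_def)
    have "expectation (\<lambda>\<omega>. exp (a (k, l) * Y k l \<omega>)) \<le> exp (if p \<in> I then D else 0)"
    proof (cases "p \<in> I")
      case True
      then have "a (k, l) = t" unfolding I kl a_def by auto
      then show ?thesis using expectation_exp_le[OF kl(2,3), of t] t True by (simp add: D_def)
    next
      case False
      then have "a (k, l) = 0" using p unfolding I kl a_def by auto
      then show ?thesis using False by (simp add: prob_space)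
    qed
    then show "0 \<le> (case p of (k, l) \<Rightarrow> expectation (\<lambda>\<omega>. exp (a (k, l) * Y k l \<omega>))) \<and>
        (case p of (k, l) \<Rightarrow> expectation (\<lambda>\<omega>. exp (a (k, l) * Y k l \<omega>))) \<le> exp (if p \<in> I then D else 0)"
      unfolding kl by auto
  qed
  also have "\<dots> = exp (\<Sum>p\<in>pairs n. if p \<in> I then D else 0)"
    by (simp add: exp_sum)
  also have "(\<Sum>p\<in>pairs n. if p \<in> I then D else 0) = real (n - 1) * D"
  proof -
    have "pairs n \<inter> I = I" using I by auto
    then show ?thesis by (subst sum.inter_restrict[symmetric]) (auto simp: cardI)
  qed
  also have "exp (real (n - 1) * D) \<le> exp (real n * D)"
    using D by (simp add: mult_right_mono)
  finally have E: "expectation (\<lambda>\<omega>. exp (t * (\<Sum>j<n. Y i j \<omega>))) \<le> exp (real n * D)" .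
  have int: "integrable M (\<lambda>\<omega>. exp (t * (\<Sum>j<n. Y i j \<omega>)))"
  proof (rule integrable_const_bound[where B = "exp (t * (real n * B))"])
    have "(\<Sum>j<n. Y i j \<omega>) \<le> real n * B" for \<omega>
    proof -
      have "(\<Sum>j<n. Y i j \<omega>) \<le> (\<Sum>j<n. B)"
        by (intro sum_mono) (use bounded in \<open>auto intro: order_trans[OF abs_ge_self]\<close>)
      then show ?thesis by simp
    qed
    then show "AE \<omega> in M. norm (exp (t * (\<Sum>j<n. Y i j \<omega>))) \<le> exp (t * (real n * B))"
      using t by (auto intro!: mult_left_mono)
  qed simp
  have "prob {\<omega> \<in> space M. (\<Sum>j<n. Y i j \<omega>) \<ge> s} = prob {\<omega> \<in> space M. exp (t * s) \<le> exp (t * (\<Sum>j<n. Y i j \<omega>))}"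
    using t by simp
  also have "\<dots> \<le> expectation (\<lambda>\<omega>. exp (t * (\<Sum>j<n. Y i j \<omega>))) / exp (t * s)"
    by (rule integral_Markov_inequality_measure[OF int, where A = "{}"]) auto
  also have "\<dots> \<le> exp (real n * D) / exp (t * s)"
    using E by (intro divide_right_mono) auto
  finally show ?thesis by (simp add: exp_diff D_def)
qed

end

text \<open>Markov's inequality, applicable because an even power has a nonnegative trace. Enlarging
  the base by \<open>exp 1\<close> wins the factor \<open>exp (- 2 * k)\<close>, which beats the
  dimension \<open>n\<close> as soon as \<open>k >= ln n\<close>.\<close>

lemma (in bounded_wigner) pow_trace_tail:
  assumes \<theta>: "\<theta> > 0" and N: "N = 2 * k"
    and \<rho>: "real N * (1 / real n + B / (\<sigma> * sqrt (real n))) * exp (\<theta> * real N) \<le> 1"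
  shows "prob {\<omega> \<in> space M. pow_trace n (\<lambda>i j. Y i j \<omega>) (2 * k)
            \<ge> ((2 / \<theta> + 1) * exp (\<theta> + 1) * \<sigma> * sqrt (real n)) ^ (2 * k)}
       \<le> real n * exp (- 2 * real k)"
proof -
  define D where "D = (2 / \<theta> + 1) * exp \<theta> * \<sigma> * sqrt (real n)"
  have D: "D > 0" unfolding D_def using \<theta> \<sigma>_pos n_pos by (intro mult_pos_pos add_pos_pos) auto
  have e: "(2 / \<theta> + 1) * exp (\<theta> + 1) * \<sigma> * sqrt (real n) = exp 1 * D"
    unfolding D_def exp_add by simp
  have pow: "(exp 1 * D) ^ (2 * k) = exp (2 * real k) * D ^ (2 * k)"
    by (simp add: power_mult_distrib exp_of_nat_mult[symmetric])
  let ?P = "\<lambda>\<omega>. pow_trace n (\<lambda>i j. Y i j \<omega>) (2 * k)"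
  have sq: "?P \<omega> \<ge> 0" for \<omega>
  proof -
    have "?P \<omega> = (\<Sum>i<n. ip n ((mvec n (\<lambda>i j. Y i j \<omega>) ^^ k) (basis i)) ((mvec n (\<lambda>i j. Y i j \<omega>) ^^ k) (basis i)))"
      unfolding pow_trace_def
      using sym by (intro sum.cong refl ip_mvec_pow_basis[symmetric]) (metis, simp)
    then show ?thesis by (simp add: sum_nonneg ip_self_nonneg)
  qed
  have "prob {\<omega> \<in> space M. ?P \<omega> \<ge> (exp 1 * D) ^ (2 * k)} \<le> expectation ?P / (exp 1 * D) ^ (2 * k)"
    using expectation_pow_trace_le(2)[OF \<theta> \<rho>] D sq N
    by (intro integral_Markov_inequality_measure[where A = "{}"]) auto
  also have "\<dots> \<le> (real n * D ^ (2 * k)) / (exp 1 * D) ^ (2 * k)"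
    using expectation_pow_trace_le(1)[OF \<theta> \<rho>] D N
    by (intro divide_right_mono) (auto simp: D_def)
  also have "\<dots> = real n * exp (- 2 * real k)"
    using D unfolding pow by (simp add: exp_minus field_simps)
  finally show ?thesis unfolding e .
qed

section \<open>The Laplacian\<close>

lemma index_laplacian:
  assumes "X \<in> carrier_mat n n" "i < n" "j < n"
  shows "laplacian X $$ (i, j) = (if i = j then \<Sum>k<n. X $$ (i, k) else 0) - X $$ (i, j)"
  using assms unfolding laplacian_def mat_diag_def by auto

lemma laplacian_carrier: "X \<in> carrier_mat n n \<Longrightarrow> laplacian X \<in> carrier_mat n n"
  unfolding laplacian_def mat_diag_def by auto

lemma transpose_laplacian:
  assumes X: "X \<in> carrier_mat n n" and sym: "transpose_mat X = X"
  shows "transpose_mat (laplacian X) = laplacian X"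
proof (rule eq_matI)
  have L: "dim_row (laplacian X) = n" "dim_col (laplacian X) = n"
    using laplacian_carrier[OF X] by auto
  fix i j assume "i < dim_row (laplacian X)" "j < dim_col (laplacian X)"
  then have ij: "i < n" "j < n" using L by auto
  have "X $$ (j, i) = X $$ (i, j)"
    using arg_cong[OF sym, of "\<lambda>B. B $$ (i, j)"] X ij by simp
  then show "transpose_mat (laplacian X) $$ (i, j) = laplacian X $$ (i, j)"
    using ij L index_laplacian[OF X] by auto
qed (use laplacian_carrier[OF X] in auto)

text \<open>The form of the Laplacian is linear in the off-diagonal entries. The part from
  \<open>Y\<close> is the row sums minus the form of \<open>Y\<close>. The constant part is
  \<open>m\<close> times \<open>n * ip n x x\<close> minus the squared sum of the coordinates, a
  quantity between 0 and \<open>n * ip n x x\<close>.\<close>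

lemma lambda_max_laplacian_le:
  assumes X: "X \<in> carrier_mat n n" and sym: "transpose_mat X = X" and n: "n \<ge> 1"
    and XY: "\<And>i j. i < n \<Longrightarrow> j < n \<Longrightarrow> i \<noteq> j \<Longrightarrow> X $$ (i, j) = Y i j + m"
    and rows: "\<And>i. i < n \<Longrightarrow> (\<Sum>j<n. Y i j) \<le> s"
    and form: "\<And>x. \<bar>ip n x (mvec n Y x)\<bar> \<le> R * ip n x x"
  shows "lambda_max (laplacian X) \<le> s + R + real n * \<bar>m\<bar>"
  unfolding lambda_max_le_iff[OF laplacian_carrier[OF X] transpose_laplacian[OF X sym] n]
proof
  fix x :: "nat \<Rightarrow> real"
  define S where "S = (\<Sum>i<n. x i)"
  have "ip n x (mvec n (\<lambda>i j. laplacian X $$ (i, j)) x) = (\<Sum>i<n. \<Sum>j<n. x i * ((Y i j + m) * (x i - x j)))"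
    unfolding ip_def
  proof (rule sum.cong[OF refl])
    fix i assume "i \<in> {..<n}"
    then have i: "i < n" by simp
    have "mvec n (\<lambda>i j. laplacian X $$ (i, j)) x i
        = (\<Sum>j<n. (if i = j then (\<Sum>k<n. X $$ (i, k)) * x i else 0) - X $$ (i, j) * x j)"
      unfolding mvec_def using i by (intro sum.cong) (auto simp: index_laplacian[OF X] algebra_simps)
    also have "\<dots> = (\<Sum>j<n. X $$ (i, j) * (x i - x j))"
      using i by (simp add: sum_subtractf sum_distrib_left algebra_simps)
    \<comment> \<open>The relation between \<open>X\<close> and \<open>Y\<close> is known off the
      diagonal only; at \<open>j = i\<close> the factor \<open>x i - x j\<close> is 0.\<close>
    also have "\<dots> = (\<Sum>j<n. (Y i j + m) * (x i - x j))"
      using XY i by (intro sum.cong refl) (metis diff_self lessThan_iff mult_zero_right)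
    finally show "x i * mvec n (\<lambda>i j. laplacian X $$ (i, j)) x i
        = (\<Sum>j<n. x i * ((Y i j + m) * (x i - x j)))"
      by (simp add: sum_distrib_left)
  qed
  also have "\<dots> = (\<Sum>i<n. (x i)\<^sup>2 * (\<Sum>j<n. Y i j)) - ip n x (mvec n Y x) + m * (real n * ip n x x - S\<^sup>2)"
  proof -
    have "S\<^sup>2 = (\<Sum>i<n. \<Sum>j<n. x i * x j)"
      unfolding S_def power2_eq_square by (simp add: sum_product)
    moreover have "real n * ip n x x = (\<Sum>i<n. \<Sum>j<n. x i * x i)"
      unfolding ip_def by (simp add: sum_distrib_left)
    moreover have "(\<Sum>i<n. \<Sum>j<n. x i * ((Y i j + m) * (x i - x j)))
        = (\<Sum>i<n. \<Sum>j<n. (x i)\<^sup>2 * Y i j - x i * (Y i j * x j) + m * (x i * x i - x i * x j))"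
      by (simp add: algebra_simps power2_eq_square)
    moreover have "(\<Sum>i<n. (x i)\<^sup>2 * (\<Sum>j<n. Y i j)) = (\<Sum>i<n. \<Sum>j<n. (x i)\<^sup>2 * Y i j)"
      by (simp add: sum_distrib_left)
    ultimately show ?thesis
      by (simp add: ip_def mvec_def sum.distrib sum_subtractf sum_distrib_left right_diff_distrib mult_ac)
  qed
  also have "\<dots> \<le> s * ip n x x + R * ip n x x + real n * \<bar>m\<bar> * ip n x x"
  proof -
    have "(\<Sum>i<n. (x i)\<^sup>2 * (\<Sum>j<n. Y i j)) \<le> (\<Sum>i<n. (x i)\<^sup>2 * s)"
      using rows by (intro sum_mono mult_left_mono) auto
    also have "\<dots> = s * ip n x x"
      unfolding ip_def by (simp add: sum_distrib_left power2_eq_square mult_ac)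
    finally have 1: "(\<Sum>i<n. (x i)\<^sup>2 * (\<Sum>j<n. Y i j)) \<le> s * ip n x x" .
    have 2: "- ip n x (mvec n Y x) \<le> R * ip n x x" using form[of x] by linarith
    have "S\<^sup>2 \<le> real n * ip n x x"
      using Cauchy_Schwarz_ineq_sum[of "\<lambda>_. 1" x "{..<n}"] unfolding S_def ip_def
      by (simp add: power2_eq_square)
    then have "\<bar>real n * ip n x x - S\<^sup>2\<bar> \<le> real n * ip n x x" by simp
    then have "\<bar>m\<bar> * \<bar>real n * ip n x x - S\<^sup>2\<bar> \<le> \<bar>m\<bar> * (real n * ip n x x)"
      by (intro mult_left_mono) auto
    then have 3: "m * (real n * ip n x x - S\<^sup>2) \<le> real n * \<bar>m\<bar> * ip n x x"
      unfolding abs_mult[symmetric] by (simp add: mult_ac)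
    show ?thesis using 1 2 3 by linarith
  qed
  finally show "ip n x (mvec n (\<lambda>i j. laplacian X $$ (i, j)) x) \<le> (s + R + real n * \<bar>m\<bar>) * ip n x x"
    by (simp add: algebra_simps)
qed

text \<open>Rational vectors make the events measurable: a countable family of quadratic forms suffices.\<close>

definition rat_vec :: "rat list \<Rightarrow> nat \<Rightarrow> real" where
  "rat_vec xs i = (if i < length xs then real_of_rat (xs ! i) else 0)"

lemma quadratic_form_le_iff_rat:
  "(\<forall>x. ip n x (mvec n A x) \<le> t * ip n x x)
    \<longleftrightarrow> (\<forall>xs. ip n (rat_vec xs) (mvec n A (rat_vec xs)) \<le> t * ip n (rat_vec xs) (rat_vec xs))"
proof (intro iffI allI)
  fix x :: "nat \<Rightarrow> real"
  assume rat: "\<forall>xs. ip n (rat_vec xs) (mvec n A (rat_vec xs)) \<le> t * ip n (rat_vec xs) (rat_vec xs)"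
  have "\<exists>q. \<forall>i. x i < real_of_rat (q i) \<and> real_of_rat (q i) < x i + 1 / real (Suc k)" for k
    by (intro choice allI of_rat_dense) auto
  then obtain q where q: "x i < real_of_rat (q k i)" "real_of_rat (q k i) < x i + 1 / real (Suc k)" for k i
    by metis
  define z where "z k = rat_vec (map (q k) [0..<n])" for k
  have z: "(\<lambda>k. z k i) \<longlonglongrightarrow> x i" if "i < n" for i
  proof (rule tendsto_sandwich)
    show "\<forall>\<^sub>F k in sequentially. x i \<le> z k i"
      using q(1) that by (auto simp: z_def rat_vec_def less_imp_le)
    show "\<forall>\<^sub>F k in sequentially. z k i \<le> x i + 1 / real (Suc k)"
      using q(2) that by (auto simp: z_def rat_vec_def less_imp_le simp del: of_nat_Suc)
    show "(\<lambda>k. x i + 1 / real (Suc k)) \<longlonglongrightarrow> x i"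
      using tendsto_add[OF tendsto_const LIMSEQ_inverse_real_of_nat, of "x i"]
      by (simp add: inverse_eq_divide)
  qed simp
  have "(\<lambda>k. ip n (z k) (mvec n A (z k))) \<longlonglongrightarrow> ip n x (mvec n A x)"
    unfolding ip_def mvec_def by (intro tendsto_intros z) auto
  moreover have "(\<lambda>k. t * ip n (z k) (z k)) \<longlonglongrightarrow> t * ip n x x"
    unfolding ip_def by (intro tendsto_intros z) auto
  ultimately show "ip n x (mvec n A x) \<le> t * ip n x x"
    using rat by (intro LIMSEQ_le[where X = "\<lambda>k. ip n (z k) (mvec n A (z k))"]) (auto simp: z_def)
qed blast

lemma wigner_matrixD:
  assumes "wigner_matrix n \<mu> M X"
  shows "prob_space M"
    and "\<omega> \<in> space M \<Longrightarrow> X \<omega> \<in> carrier_mat n n"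
    and "\<omega> \<in> space M \<Longrightarrow> transpose_mat (X \<omega>) = X \<omega>"
    and "i < n \<Longrightarrow> j < n \<Longrightarrow> (\<lambda>\<omega>. X \<omega> $$ (i, j)) \<in> borel_measurable M"
    and "prob_space.indep_vars M (\<lambda>_. borel) (\<lambda>(i, j) \<omega>. X \<omega> $$ (i, j)) (pairs n)"
    and "i < j \<Longrightarrow> j < n \<Longrightarrow> distr M borel (\<lambda>\<omega>. X \<omega> $$ (i, j)) = \<mu>"
  using assms unfolding wigner_matrix_def pairs_def by blast+

text \<open>Needed because \<open>measure\<close> is 0 on sets that are not measurable: a lower
  bound for the probability requires the conclusion to be an event.\<close>

lemma lambda_max_laplacian_event:
  assumes W: "wigner_matrix n \<mu> M X" and n: "n \<ge> 1"
  shows "{\<omega> \<in> space M. lambda_max (laplacian (X \<omega>)) \<le> K * max_diag (laplacian (X \<omega>))} \<in> sets M"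
proof -
  note X = wigner_matrixD[OF W]
  define L where "L i j \<omega> = (if i = j then \<Sum>k<n. X \<omega> $$ (i, k) else 0) - X \<omega> $$ (i, j)" for i j \<omega>
  have L: "laplacian (X \<omega>) $$ (i, j) = L i j \<omega>" if "\<omega> \<in> space M" "i < n" "j < n" for i j \<omega>
    unfolding L_def using index_laplacian[OF X(2)[OF that(1)] that(2,3)] .
  have Lm: "L i j \<in> borel_measurable M" if "i < n" "j < n" for i j
  proof -
    have "(\<lambda>\<omega>. \<Sum>k<n. X \<omega> $$ (i, k)) \<in> borel_measurable M"
      using that by (intro borel_measurable_sum X(4)) auto
    then show ?thesis unfolding L_def using X(4)[OF that] by (cases "i = j") auto
  qed
  define D where "D \<omega> = (MAX i\<in>{..<n}. L i i \<omega>)" for \<omega>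
  have D: "max_diag (laplacian (X \<omega>)) = D \<omega>" if "\<omega> \<in> space M" for \<omega>
    unfolding max_diag_def D_def using laplacian_carrier[OF X(2)[OF that]] L[OF that]
    by (intro arg_cong[where f = Max] image_cong) auto
  have [measurable]: "D \<in> borel_measurable M"
    unfolding D_def[abs_def] by (intro borel_measurable_Max Lm) auto
  have q: "(\<lambda>\<omega>. ip n x (mvec n (\<lambda>i j. L i j \<omega>) x)) \<in> borel_measurable M" for x
    unfolding ip_def mvec_def
    by (intro borel_measurable_sum borel_measurable_times borel_measurable_const Lm) auto
  have "lambda_max (laplacian (X \<omega>)) \<le> K * max_diag (laplacian (X \<omega>)) \<longleftrightarrow>
      (\<forall>xs. ip n (rat_vec xs) (mvec n (\<lambda>i j. L i j \<omega>) (rat_vec xs)) \<le> K * D \<omega> * ip n (rat_vec xs) (rat_vec xs))"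
    if \<omega>: "\<omega> \<in> space M" for \<omega>
  proof -
    have "ip n x (mvec n (\<lambda>i j. laplacian (X \<omega>) $$ (i, j)) x) = ip n x (mvec n (\<lambda>i j. L i j \<omega>) x)" for x
      unfolding ip_def mvec_def using L[OF \<omega>] by simp
    then show ?thesis
      unfolding D[OF \<omega>] quadratic_form_le_iff_rat[symmetric]
      by (subst lambda_max_le_iff[OF laplacian_carrier[OF X(2)[OF \<omega>]] transpose_laplacian[OF X(2,3)[OF \<omega>]] n]) simp
  qed
  then have "{\<omega> \<in> space M. lambda_max (laplacian (X \<omega>)) \<le> K * max_diag (laplacian (X \<omega>))} =
      {\<omega> \<in> space M. \<forall>xs. ip n (rat_vec xs) (mvec n (\<lambda>i j. L i j \<omega>) (rat_vec xs))
        \<le> K * D \<omega> * ip n (rat_vec xs) (rat_vec xs)}" by blast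
  also have "\<dots> \<in> sets M"
    by (intro sets.sets_Collect_countable_All borel_measurable_le q) measurable
  finally show ?thesis .
qed

section \<open>Truncation\<close>

locale centred_law = real_distribution \<mu> for \<mu> :: "real measure" +
  fixes \<sigma> p :: real
  assumes \<sigma>_pos: "\<sigma> > 0" and p_gt: "p > 2"
    and moment: "integrable \<mu> (\<lambda>x. \<bar>x\<bar> powr p)"
    and mean0: "expectation (\<lambda>x. x) = 0"
    and var: "variance (\<lambda>x. x) = \<sigma>\<^sup>2"
begin

lemma prob_UNIV: "prob UNIV = 1"
  using prob_space unfolding space_eq_univ .

definition abs_moment :: real where
  "abs_moment = expectation (\<lambda>x. \<bar>x\<bar> powr p)"

lemma abs_moment_nonneg: "abs_moment \<ge> 0"
  unfolding abs_moment_def by simp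

lemma integrable_square: "integrable \<mu> (\<lambda>x. x\<^sup>2)"
proof (rule Bochner_Integration.integrable_bound)
  show "integrable \<mu> (\<lambda>x. 1 + \<bar>x\<bar> powr p)" using moment by simp
  have "x\<^sup>2 \<le> 1 + \<bar>x\<bar> powr p" for x :: real
  proof (cases "\<bar>x\<bar> \<le> 1")
    case True
    then have "x\<^sup>2 \<le> 1" by (simp add: abs_square_le_1)
    then show ?thesis by (simp add: add_increasing2)
  next
    case False
    then have "\<bar>x\<bar> powr 2 \<le> \<bar>x\<bar> powr p" using p_gt by (intro powr_mono) auto
    then show ?thesis using False by simp
  qed
  then show "AE x in \<mu>. norm (x\<^sup>2) \<le> norm (1 + \<bar>x\<bar> powr p)" by (simp add: add_nonneg_nonneg)
qed simp

lemma integrable_id: "integrable \<mu> (\<lambda>x. x)"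
proof (rule Bochner_Integration.integrable_bound)
  show "integrable \<mu> (\<lambda>x. 1 + x\<^sup>2)" using integrable_square by simp
  have "\<bar>x\<bar> \<le> 1 + x\<^sup>2" for x :: real
    using zero_le_power2[of "\<bar>x\<bar> - 1"] by (simp add: power2_eq_square algebra_simps)
  then show "AE x in \<mu>. norm x \<le> norm (1 + x\<^sup>2)" by simp
qed simp

lemma second_moment: "expectation (\<lambda>x. x\<^sup>2) = \<sigma>\<^sup>2"
  using var mean0 by simp

definition trunc :: "real \<Rightarrow> real \<Rightarrow> real" where
  "trunc T x = (if \<bar>x\<bar> \<le> T then x else 0)"

definition trunc_mean :: "real \<Rightarrow> real" where
  "trunc_mean T = expectation (trunc T)"

lemma trunc_measurable [measurable]: "trunc T \<in> borel_measurable borel"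
  unfolding trunc_def[abs_def] by measurable

lemma abs_trunc_le: "T \<ge> 0 \<Longrightarrow> \<bar>trunc T x\<bar> \<le> T"
  unfolding trunc_def by auto

lemma integrable_trunc: "T \<ge> 0 \<Longrightarrow> integrable \<mu> (trunc T)"
  using abs_trunc_le by (intro integrable_const_bound[where B = T]) auto

lemma abs_trunc_mean_le: "T \<ge> 0 \<Longrightarrow> \<bar>trunc_mean T\<bar> \<le> T"
proof -
  assume T: "T \<ge> 0"
  have "\<bar>trunc_mean T\<bar> \<le> expectation (\<lambda>x. \<bar>trunc T x\<bar>)"
    unfolding trunc_mean_def by (rule integral_abs_bound)
  also have "\<dots> \<le> expectation (\<lambda>x. T)"
    using integrable_trunc[OF T] abs_trunc_le[OF T] by (intro integral_mono) auto
  finally show ?thesis by (simp add: prob_UNIV)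
qed

text \<open>As the full mean is 0, the truncated mean is minus the mean over the tail, where
  \<open>|x|\<close> is at most \<open>T powr (1 - p) * |x| powr p\<close>.\<close>

lemma abs_trunc_mean_le_moment:
  assumes T: "T > 0"
  shows "\<bar>trunc_mean T\<bar> \<le> T powr (1 - p) * abs_moment"
proof -
  have "trunc_mean T = - expectation (\<lambda>x. x - trunc T x)"
    using integrable_id integrable_trunc[of T] T mean0 unfolding trunc_mean_def by simp
  then have "\<bar>trunc_mean T\<bar> \<le> expectation (\<lambda>x. \<bar>x - trunc T x\<bar>)"
    using integral_abs_bound[of \<mu> "\<lambda>x. x - trunc T x"] by simp
  also have "\<dots> \<le> expectation (\<lambda>x. T powr (1 - p) * \<bar>x\<bar> powr p)"
  proof (rule integral_mono)
    show "integrable \<mu> (\<lambda>x. \<bar>x - trunc T x\<bar>)"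
      using integrable_id integrable_trunc[of T] T by simp
    show "integrable \<mu> (\<lambda>x. T powr (1 - p) * \<bar>x\<bar> powr p)" using moment by simp
    fix x :: real
    show "\<bar>x - trunc T x\<bar> \<le> T powr (1 - p) * \<bar>x\<bar> powr p"
    proof (cases "\<bar>x\<bar> \<le> T")
      case True
      then show ?thesis by (simp add: trunc_def)
    next
      case False
      then have "\<bar>x\<bar> = \<bar>x\<bar> powr (1 - p) * \<bar>x\<bar> powr p" using T by (simp add: powr_add[symmetric])
      also have "\<dots> \<le> T powr (1 - p) * \<bar>x\<bar> powr p"
        using False T p_gt by (intro mult_right_mono powr_mono2') auto
      finally show ?thesis using False by (simp add: trunc_def)
    qed
  qed
  finally show ?thesis by (simp add: abs_moment_def)
qed

lemma tail_prob_le: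
  assumes T: "T > 0"
  shows "prob {x. \<bar>x\<bar> > T} \<le> T powr (- p) * abs_moment"
proof -
  have "prob {x. \<bar>x\<bar> > T} \<le> prob {x \<in> space \<mu>. \<bar>x\<bar> powr p \<ge> T powr p}"
    using T p_gt by (intro finite_measure_mono) (auto intro!: powr_mono2)
  also have "\<dots> \<le> abs_moment / T powr p"
    unfolding abs_moment_def
    using T by (intro integral_Markov_inequality_measure[OF moment, where A = "{}"]) auto
  finally show ?thesis by (simp add: powr_minus field_simps)
qed

lemma centred_trunc:
  assumes T: "T \<ge> 0"
  shows "expectation (\<lambda>x. trunc T x - trunc_mean T) = 0"
    and "expectation (\<lambda>x. (trunc T x - trunc_mean T)\<^sup>2) \<le> \<sigma>\<^sup>2"
proof -
  show "expectation (\<lambda>x. trunc T x - trunc_mean T) = 0"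
    using integrable_trunc[OF T] by (simp add: trunc_mean_def prob_UNIV)
  have int2: "integrable \<mu> (\<lambda>x. (trunc T x)\<^sup>2)"
    by (rule Bochner_Integration.integrable_bound[OF integrable_square]) (auto simp: trunc_def)
  have "expectation (\<lambda>x. (trunc T x - trunc_mean T)\<^sup>2)
      = expectation (\<lambda>x. (trunc T x)\<^sup>2) - (trunc_mean T)\<^sup>2"
    using variance_eq[OF integrable_trunc[OF T] int2] by (simp add: trunc_mean_def)
  also have "\<dots> \<le> expectation (\<lambda>x. (trunc T x)\<^sup>2)" by simp
  also have "\<dots> \<le> expectation (\<lambda>x. x\<^sup>2)"
    using int2 integrable_square by (intro integral_mono) (auto simp: trunc_def)
  finally show "expectation (\<lambda>x. (trunc T x - trunc_mean T)\<^sup>2) \<le> \<sigma>\<^sup>2"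
    by (simp add: second_moment)
qed

text \<open>Always reads the entry above the diagonal. The locale \<open>bounded_wigner\<close> asks
  for symmetry at every \<omega>, whereas \<open>X \<omega>\<close> is known to be symmetric only on
  \<open>space M\<close>.\<close>

definition trunc_entry :: "nat \<Rightarrow> real \<Rightarrow> real mat \<Rightarrow> nat \<Rightarrow> nat \<Rightarrow> real" where
  "trunc_entry n T A i j =
     (if i < n \<and> j < n \<and> i \<noteq> j then trunc T (A $$ (min i j, max i j)) - trunc_mean T else 0)"

lemma bounded_wigner_trunc_entry:
  assumes W: "wigner_matrix n \<mu> M X" and n: "n \<ge> 1" and T: "T \<ge> 0"
  shows "bounded_wigner M n (\<lambda>i j \<omega>. trunc_entry n T (X \<omega>) i j) \<sigma> (2 * T)"
proof -
  note X = wigner_matrixD[OF W]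
  interpret M: prob_space M by (rule X(1))
  let ?Y = "\<lambda>i j \<omega>. trunc_entry n T (X \<omega>) i j"
  let ?f = "\<lambda>x. trunc T x - trunc_mean T"
  have expect: "M.expectation (\<lambda>\<omega>. g (?Y i j \<omega>)) = expectation (\<lambda>x. g (?f x))"
    if "i < j" "j < n" and g[measurable]: "g \<in> borel_measurable borel" for i j and g :: "real \<Rightarrow> real"
  proof -
    have "expectation (\<lambda>x. g (?f x)) = integral\<^sup>L (distr M borel (\<lambda>\<omega>. X \<omega> $$ (i, j))) (\<lambda>x. g (?f x))"
      using X(6)[OF that(1,2)] by simp
    also have "\<dots> = M.expectation (\<lambda>\<omega>. g (?f (X \<omega> $$ (i, j))))"
      using that by (intro integral_distr X(4)) auto
    also have "\<dots> = M.expectation (\<lambda>\<omega>. g (?Y i j \<omega>))"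
      using that by (simp add: trunc_entry_def)
    finally show ?thesis by simp
  qed
  show ?thesis
  proof
    show "n \<ge> 1" "\<sigma> > 0" "0 \<le> 2 * T" using n \<sigma>_pos T by auto
    show "(\<lambda>\<omega>. trunc_entry n T (X \<omega>) i j) = (\<lambda>\<omega>. trunc_entry n T (X \<omega>) j i)" for i j
      by (auto simp: trunc_entry_def min.commute max.commute)
    show "trunc_entry n T (X \<omega>) i i = 0" for i \<omega> by (simp add: trunc_entry_def)
    show "(\<lambda>\<omega>. trunc_entry n T (X \<omega>) i j) \<in> borel_measurable M" for i j
    proof (cases "i < n \<and> j < n \<and> i \<noteq> j")
      case True
      have [measurable]: "(\<lambda>\<omega>. X \<omega> $$ (min i j, max i j)) \<in> borel_measurable M"
        using True by (intro X(4)) auto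
      have "(\<lambda>\<omega>. trunc T (X \<omega> $$ (min i j, max i j)) - trunc_mean T) \<in> borel_measurable M"
        by measurable
      then show ?thesis using True by (simp add: trunc_entry_def)
    next
      case False
      then have "(\<lambda>\<omega>. trunc_entry n T (X \<omega>) i j) = (\<lambda>_. 0)" by (auto simp: trunc_entry_def)
      then show ?thesis by simp
    qed
    show "\<bar>trunc_entry n T (X \<omega>) i j\<bar> \<le> 2 * T" for i j \<omega>
      using abs_trunc_le[OF T, of "X \<omega> $$ (min i j, max i j)"] abs_trunc_mean_le[OF T] T
      unfolding trunc_entry_def by auto
    have "M.indep_vars (\<lambda>_. borel) (\<lambda>p \<omega>. ?f ((case p of (i, j) \<Rightarrow> \<lambda>\<omega>. X \<omega> $$ (i, j)) \<omega>)) (pairs n)"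
      by (rule M.indep_vars_compose2[OF X(5)]) measurable
    then show "M.indep_vars (\<lambda>_. borel) (\<lambda>(i, j) \<omega>. trunc_entry n T (X \<omega>) i j) (pairs n)"
      by (rule M.indep_vars_cong[THEN iffD1, rotated -1])
         (auto simp: pairs_def trunc_entry_def fun_eq_iff)
    fix i j assume ij: "i < j" "j < n"
    show "M.expectation (\<lambda>\<omega>. trunc_entry n T (X \<omega>) i j) = 0"
      using expect[OF ij, of "\<lambda>x. x"] centred_trunc(1)[OF T] by simp
    show "M.expectation (\<lambda>\<omega>. (trunc_entry n T (X \<omega>) i j)\<^sup>2) \<le> \<sigma>\<^sup>2"
      using expect[OF ij, of "\<lambda>x. x\<^sup>2"] centred_trunc(2)[OF T] by simp
  qed
qed

text \<open>Nonasymptotic, with all parameters free. The three summands in the bound for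
  \<open>E\<close> belong to a large entry, a large row sum and a large trace; off \<open>E\<close>
  everything is deterministic.\<close>

lemma lambda_max_laplacian_tail:
  assumes W: "wigner_matrix n \<mu> M X" and n: "n \<ge> 1" and T: "T > 0" and t: "t > 0"
    and \<theta>: "\<theta> > 0" and k: "k = 2 ^ l"
    and \<rho>: "real (2 * k) * (1 / real n + 2 * T / (\<sigma> * sqrt (real n))) * exp (\<theta> * real (2 * k)) \<le> 1"
  obtains E where "E \<in> sets M"
    and "measure M E \<le> (real n)\<^sup>2 * (T powr (- p) * abs_moment)
        + real n * exp (real n * (t\<^sup>2 * \<sigma>\<^sup>2 / 2 * exp (t * (2 * T))) - t * s)
        + real n * exp (- 2 * real k)"
    and "\<And>\<omega>. \<omega> \<in> space M - E \<Longrightarrow> lambda_max (laplacian (X \<omega>))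
        \<le> s + (2 / \<theta> + 1) * exp (\<theta> + 1) * \<sigma> * sqrt (real n) + real n * (T powr (1 - p) * abs_moment)"
proof -
  note X = wigner_matrixD[OF W]
  define Y where "Y i j \<omega> = trunc_entry n T (X \<omega>) i j" for i j \<omega>
  define R where "R = (2 / \<theta> + 1) * exp (\<theta> + 1) * \<sigma> * sqrt (real n)"
  interpret bw: bounded_wigner M n Y \<sigma> "2 * T"
    unfolding Y_def[abs_def] using bounded_wigner_trunc_entry[OF W n] T by simp
  define E1 where "E1 = (\<Union>e\<in>pairs n. {\<omega> \<in> space M. \<bar>X \<omega> $$ e\<bar> > T})"
  define E2 where "E2 = (\<Union>i\<in>{..<n}. {\<omega> \<in> space M. (\<Sum>j<n. Y i j \<omega>) \<ge> s})"
  define E3 where "E3 = {\<omega> \<in> space M. pow_trace n (\<lambda>i j. Y i j \<omega>) (2 * k) \<ge> R ^ (2 * k)}"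
  have E1p: "{\<omega> \<in> space M. \<bar>X \<omega> $$ (i, j)\<bar> > T} \<in> sets M"
    "measure M {\<omega> \<in> space M. \<bar>X \<omega> $$ (i, j)\<bar> > T} \<le> T powr (- p) * abs_moment"
    if "(i, j) \<in> pairs n" for i j
  proof -
    have ij: "i < j" "j < n" using that by (auto simp: pairs_def)
    have m[measurable]: "(\<lambda>\<omega>. X \<omega> $$ (i, j)) \<in> borel_measurable M" using ij by (intro X(4)) auto
    show "{\<omega> \<in> space M. \<bar>X \<omega> $$ (i, j)\<bar> > T} \<in> sets M" by measurable
    have "measure M {\<omega> \<in> space M. \<bar>X \<omega> $$ (i, j)\<bar> > T}
        = measure (distr M borel (\<lambda>\<omega>. X \<omega> $$ (i, j))) {x. \<bar>x\<bar> > T}"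
      by (subst measure_distr[OF m]) (auto intro!: arg_cong[where f = "measure M"])
    also have "\<dots> \<le> T powr (- p) * abs_moment"
      unfolding X(6)[OF ij] by (rule tail_prob_le[OF T])
    finally show "measure M {\<omega> \<in> space M. \<bar>X \<omega> $$ (i, j)\<bar> > T} \<le> T powr (- p) * abs_moment" .
  qed
  have E1: "E1 \<in> sets M" unfolding E1_def using E1p(1) by (intro sets.finite_UN) auto
  have E2: "E2 \<in> sets M" unfolding E2_def by (intro sets.finite_UN) auto
  have "integrable M (\<lambda>\<omega>. pow_trace n (\<lambda>i j. Y i j \<omega>) (2 * k))"
    using bw.expectation_pow_trace_le(2)[OF \<theta> \<rho>] .
  then have E3: "E3 \<in> sets M" unfolding E3_def by measurable
  have "measure M E1 \<le> (\<Sum>e\<in>pairs n. measure M {\<omega> \<in> space M. \<bar>X \<omega> $$ e\<bar> > T})"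
    unfolding E1_def using E1p(1) by (intro bw.finite_measure_subadditive_finite) auto
  also have "\<dots> \<le> (\<Sum>e\<in>pairs n. T powr (- p) * abs_moment)"
    using E1p(2) by (intro sum_mono) auto
  also have "\<dots> = real (card (pairs n)) * (T powr (- p) * abs_moment)" by simp
  also have "\<dots> \<le> (real n)\<^sup>2 * (T powr (- p) * abs_moment)"
  proof (intro mult_right_mono mult_nonneg_nonneg abs_moment_nonneg)
    have "card (pairs n) \<le> card ({..<n} \<times> {..<n})"
      by (intro card_mono) (auto simp: pairs_def)
    then show "real (card (pairs n)) \<le> (real n)\<^sup>2"
      by (simp add: power2_eq_square flip: of_nat_mult)
  qed simp
  finally have P1: "measure M E1 \<le> (real n)\<^sup>2 * (T powr (- p) * abs_moment)" .
  have "measure M E2 \<le> (\<Sum>i<n. measure M {\<omega> \<in> space M. (\<Sum>j<n. Y i j \<omega>) \<ge> s})"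
    unfolding E2_def by (intro bw.finite_measure_subadditive_finite) auto
  also have "\<dots> \<le> (\<Sum>i<n. exp (real n * (t\<^sup>2 * \<sigma>\<^sup>2 / 2 * exp (t * (2 * T))) - t * s))"
    by (intro sum_mono bw.row_sum_tail t) auto
  finally have P2: "measure M E2 \<le> real n * exp (real n * (t\<^sup>2 * \<sigma>\<^sup>2 / 2 * exp (t * (2 * T))) - t * s)"
    by simp
  have P3: "measure M E3 \<le> real n * exp (- 2 * real k)"
    unfolding E3_def R_def using bw.pow_trace_tail[OF \<theta> refl \<rho>] .
  show ?thesis
  proof (rule that[of "E1 \<union> E2 \<union> E3"])
    show "E1 \<union> E2 \<union> E3 \<in> sets M" using E1 E2 E3 by auto
    have "measure M (E1 \<union> E2 \<union> E3) \<le> measure M E1 + measure M E2 + measure M E3"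
      using measure_Un_le[of "E1 \<union> E2" M E3] measure_Un_le[of E1 M E2] E1 E2 E3 by auto
    then show "measure M (E1 \<union> E2 \<union> E3) \<le> (real n)\<^sup>2 * (T powr (- p) * abs_moment)
        + real n * exp (real n * (t\<^sup>2 * \<sigma>\<^sup>2 / 2 * exp (t * (2 * T))) - t * s)
        + real n * exp (- 2 * real k)"
      using P1 P2 P3 by linarith
    fix \<omega> assume \<omega>: "\<omega> \<in> space M - (E1 \<union> E2 \<union> E3)"
    then have \<omega>M: "\<omega> \<in> space M" by simp
    have "lambda_max (laplacian (X \<omega>)) \<le> s + R + real n * \<bar>trunc_mean T\<bar>"
    proof (rule lambda_max_laplacian_le[where Y = "\<lambda>i j. Y i j \<omega>"])
      show "X \<omega> \<in> carrier_mat n n" "transpose_mat (X \<omega>) = X \<omega>" using X(2,3) \<omega>M by auto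
      show "n \<ge> 1" by (rule n)
      show "(\<Sum>j<n. Y i j \<omega>) \<le> s" if "i < n" for i
        using \<omega> that unfolding E2_def by (auto simp: not_le less_imp_le)
      show "X \<omega> $$ (i, j) = Y i j \<omega> + trunc_mean T" if ij: "i < n" "j < n" "i \<noteq> j" for i j
      proof -
        have "X \<omega> $$ (i, j) = X \<omega> $$ (min i j, max i j)"
        proof (cases "i < j")
          case False
          then show ?thesis
            using arg_cong[OF X(3)[OF \<omega>M], of "\<lambda>B. B $$ (i, j)"] X(2)[OF \<omega>M] ij
            by (simp add: min_def max_def)
        qed simp
        moreover have "(min i j, max i j) \<in> pairs n" using ij by (auto simp: pairs_def)
        then have "\<bar>X \<omega> $$ (min i j, max i j)\<bar> \<le> T" using \<omega> unfolding E1_def by fastforce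
        ultimately show ?thesis using ij by (simp add: Y_def trunc_entry_def trunc_def)
      qed
      show "\<bar>ip n x (mvec n (\<lambda>i j. Y i j \<omega>) x)\<bar> \<le> R * ip n x x" for x
      proof (rule abs_quadratic_form_le_of_pow_trace[OF _ k])
        show "Y i j \<omega> = Y j i \<omega>" for i j using bw.sym[of i j] by simp
        show "0 \<le> R" unfolding R_def using \<theta> \<sigma>_pos by simp
        show "pow_trace n (\<lambda>i j. Y i j \<omega>) (2 * k) \<le> R ^ (2 * k)"
          using \<omega> unfolding E3_def by auto
      qed
    qed
    moreover have "real n * \<bar>trunc_mean T\<bar> \<le> real n * (T powr (1 - p) * abs_moment)"
      using abs_trunc_mean_le_moment[OF T] by (intro mult_left_mono) auto
    ultimately show "lambda_max (laplacian (X \<omega>))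
        \<le> s + (2 / \<theta> + 1) * exp (\<theta> + 1) * \<sigma> * sqrt (real n) + real n * (T powr (1 - p) * abs_moment)"
      unfolding R_def[symmetric] by simp
  qed
qed

end

section \<open>Asymptotics\<close>

text \<open>Chooses the half-power \<open>k\<close> near \<open>ln n\<close>. The lower bound makes
  \<open>n * exp (- 2 * k)\<close> at most \<open>1 / n\<close>; the upper bound keeps
  \<open>exp (\<theta> * 2 * k)\<close> a small power of \<open>n\<close>.\<close>

lemma ex_power_of_two_between:
  fixes x :: real
  assumes "x \<ge> 0"
  obtains l :: nat where "x \<le> 2 ^ l" "2 ^ l \<le> 2 * x + 1"
proof -
  have ex: "\<exists>l :: nat. x \<le> 2 ^ l"
    using real_arch_pow[of 2 x] by (auto intro: less_imp_le)
  define l where "l = (LEAST l. x \<le> 2 ^ l)"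
  have "x \<le> 2 ^ l" unfolding l_def using ex by (rule LeastI_ex)
  moreover have "2 ^ l \<le> 2 * x + 1"
  proof (cases l)
    case 0
    then show ?thesis using assms by simp
  next
    case (Suc l')
    then have "\<not> x \<le> 2 ^ l'" unfolding l_def by (intro not_less_Least) simp
    then show ?thesis using Suc by simp
  qed
  ultimately show ?thesis using that by blast
qed

text \<open>\<open>4 * ln n + 2\<close> bounds the power \<open>2 * k\<close>. With \<theta> = 1/32
  the exponential is of order \<open>n powr (1 / 8)\<close>, which loses against
  \<open>n powr (1 / 3) / sqrt n\<close>, of order \<open>n powr (- (1 / 6))\<close>.\<close>

lemma eventually_spectral_condition:
  fixes \<sigma> :: real
  assumes \<sigma>: "\<sigma> > 0"
  shows "\<forall>\<^sub>F n in sequentially. (4 * ln (real n) + 2) *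
    (1 / real n + 2 * real n powr (1 / 3) / (\<sigma> * sqrt (real n))) *
    exp (1 / 32 * (4 * ln (real n) + 2)) \<le> 1"
proof -
  have 1: "(\<lambda>n. (4 * ln (real n) + 2) * (1 / real n) * exp (1 / 32 * (4 * ln (real n) + 2))) \<longlonglongrightarrow> 0"
    by real_asymp
  have 2: "(\<lambda>n. (4 * ln (real n) + 2) * (real n powr (1 / 3) / sqrt (real n)) *
      exp (1 / 32 * (4 * ln (real n) + 2))) \<longlonglongrightarrow> 0"
    by real_asymp
  have eq: "L * (x + 2 * u / (\<sigma> * w)) * E = L * x * E + 2 / \<sigma> * (L * (u / w) * E)" for L x u w E :: real
    using \<sigma> by (cases "w = 0") (auto simp: field_simps)
  have "(\<lambda>n. (4 * ln (real n) + 2) *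
    (1 / real n + 2 * real n powr (1 / 3) / (\<sigma> * sqrt (real n))) *
    exp (1 / 32 * (4 * ln (real n) + 2))) \<longlonglongrightarrow> 0 + 2 / \<sigma> * 0"
    unfolding eq by (intro tendsto_intros 1 2)
  then show ?thesis by (intro eventually_mono[OF order_tendstoD(2)[of _ "0 + 2 / \<sigma> * 0" _ 1]]) auto
qed

text \<open>For the threshold \<open>s = a * \<sigma> * sqrt (n * ln n)\<close> the parameter
  \<open>t\<close> is the Gaussian optimiser \<open>s / (n * \<sigma>^2)\<close>. Since
  \<open>t\<close> times the entry bound tends to 0, the exponent is \<open>- a^2 / 2 * ln n\<close>
  to first order, and \<open>a^2 > 2\<close> beats the factor \<open>n\<close>.\<close>

lemma eventually_row_sum_term_le:
  fixes \<sigma> \<epsilon> \<eta> :: real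
  assumes pos: "\<sigma> > 0" "\<epsilon> > 0" "\<eta> > 0"
  defines "a \<equiv> sqrt (2 + \<epsilon> / 2)"
  shows "\<forall>\<^sub>F n in sequentially. real n * exp (real n *
      ((a * sqrt (ln (real n) / real n) / \<sigma>)\<^sup>2 * \<sigma>\<^sup>2 / 2 *
        exp (a * sqrt (ln (real n) / real n) / \<sigma> * (2 * real n powr (1 / 3))))
      - a * sqrt (ln (real n) / real n) / \<sigma> * (a * \<sigma> * sqrt (real n * ln (real n)))) \<le> \<eta>"
proof -
  have a: "a > 0" "a\<^sup>2 = 2 + \<epsilon> / 2" using pos unfolding a_def by (auto simp: add_nonneg_nonneg)
  \<comment> \<open>Chosen so that the error factor \<open>1 + \<delta>\<close> uses up half of the
    margin: the exponent \<open>- (1 + \<epsilon> / 4)\<close> of \<open>n\<close> becomes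
    \<open>- (1 + \<epsilon> / 8)\<close>.\<close>
  define \<delta> where "\<delta> = \<epsilon> / (8 + 2 * \<epsilon>)"
  have \<delta>: "\<delta> > 0" using pos unfolding \<delta>_def by simp
  have \<delta>_eq: "(2 + \<epsilon> / 2) * ((1 + \<delta>) / 2 - 1) = - (1 + \<epsilon> / 8)"
    using pos unfolding \<delta>_def by (simp add: field_simps)
  have "(\<lambda>n. sqrt (ln (real n) / real n) * real n powr (1 / 3)) \<longlonglongrightarrow> 0" by real_asymp
  from tendsto_mult[OF tendsto_const[of "2 * a / \<sigma>"] this]
  have "(\<lambda>n. a * sqrt (ln (real n) / real n) / \<sigma> * (2 * real n powr (1 / 3))) \<longlonglongrightarrow> 0"
    by (simp add: mult_ac)
  from tendsto_exp[OF this]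
  have "(\<lambda>n. exp (a * sqrt (ln (real n) / real n) / \<sigma> * (2 * real n powr (1 / 3)))) \<longlonglongrightarrow> 1"
    by simp
  then have ev1: "\<forall>\<^sub>F n in sequentially.
      exp (a * sqrt (ln (real n) / real n) / \<sigma> * (2 * real n powr (1 / 3))) < 1 + \<delta>"
    using \<delta> by (intro order_tendstoD(2)) auto
  have "(\<lambda>n. real n powr (- (\<epsilon> / 8))) \<longlonglongrightarrow> 0"
    using pos by (intro tendsto_neg_powr filterlim_real_sequentially) auto
  then have ev2: "\<forall>\<^sub>F n in sequentially. real n powr (- (\<epsilon> / 8)) < \<eta>"
    using pos by (intro order_tendstoD(2)) auto
  show ?thesis
    using ev1 ev2 eventually_ge_at_top[of 3]
  proof eventually_elim
    case (elim n)
    define e where "e = exp (a * sqrt (ln (real n) / real n) / \<sigma> * (2 * real n powr (1 / 3)))"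
    have n: "real n > 0" "ln (real n) \<ge> 0" using elim by auto
    have 1: "real n * ((a * sqrt (ln (real n) / real n) / \<sigma>)\<^sup>2 * \<sigma>\<^sup>2 / 2 * e) = a\<^sup>2 * ln (real n) * (e / 2)"
      using n pos by (simp add: power_mult_distrib power_divide field_simps)
    have "sqrt (ln (real n) / real n) * sqrt (real n * ln (real n)) = sqrt ((ln (real n))\<^sup>2)"
      using n by (subst real_sqrt_mult[symmetric]) (simp add: power2_eq_square)
    then have "sqrt (ln (real n) / real n) * sqrt (real n * ln (real n)) = ln (real n)"
      using n by simp
    moreover have "a * sqrt (ln (real n) / real n) / \<sigma> * (a * \<sigma> * sqrt (real n * ln (real n)))
        = a\<^sup>2 * (sqrt (ln (real n) / real n) * sqrt (real n * ln (real n)))"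
      using pos by (simp add: power2_eq_square)
    ultimately have 2: "a * sqrt (ln (real n) / real n) / \<sigma> * (a * \<sigma> * sqrt (real n * ln (real n))) = a\<^sup>2 * ln (real n)"
      by simp
    have "a\<^sup>2 * ln (real n) * (e / 2) - a\<^sup>2 * ln (real n) = ln (real n) * ((2 + \<epsilon> / 2) * (e / 2 - 1))"
      unfolding a by (simp add: algebra_simps)
    also have "\<dots> \<le> ln (real n) * ((2 + \<epsilon> / 2) * ((1 + \<delta>) / 2 - 1))"
      using elim(1) n pos unfolding e_def[symmetric] by (intro mult_left_mono) auto
    also have "\<dots> = - (1 + \<epsilon> / 8) * ln (real n)" unfolding \<delta>_eq by simp
    finally have "real n * exp (a\<^sup>2 * ln (real n) * (e / 2) - a\<^sup>2 * ln (real n))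
        \<le> real n * exp (- (1 + \<epsilon> / 8) * ln (real n))"
      by (intro mult_left_mono) auto
    also have "\<dots> = exp (ln (real n)) * exp (- (1 + \<epsilon> / 8) * ln (real n))"
      using n by simp
    also have "\<dots> = real n powr (- (\<epsilon> / 8))"
      unfolding exp_add[symmetric] powr_def using n by (simp add: algebra_simps)
    also have "\<dots> \<le> \<eta>" using elim(2) by simp
    finally show ?case unfolding e_def[symmetric] 1 2 .
  qed
qed

text \<open>The quantifiers over \<open>M\<close> and \<open>X\<close> stand inside
  \<open>eventually\<close> because the probability space changes with \<open>n\<close>; the
  threshold depends only on the law, \<epsilon> and \<eta>.\<close>

lemma (in centred_law) lambda_max_laplacian_whp:
  assumes p6: "p > 6" and pos: "\<epsilon> > 0" "\<eta> > 0"
  shows "\<forall>\<^sub>F n in sequentially. \<forall>(M :: 'a measure) X. wigner_matrix n \<mu> M X \<longrightarrow>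
    (\<exists>E\<in>sets M. measure M E \<le> \<eta> \<and> (\<forall>\<omega>\<in>space M - E.
      lambda_max (laplacian (X \<omega>)) \<le> sqrt (2 + \<epsilon>) * \<sigma> * sqrt (real n * ln (real n))))"
proof -
  define a where "a = sqrt (2 + \<epsilon> / 2)"
  have a: "a > 0" using pos unfolding a_def by simp
  define C where "C = (2 / (1 / 32) + 1) * exp (1 / 32 + 1) * \<sigma>"
  have C: "C > 0" using \<sigma>_pos unfolding C_def by simp
  \<comment> \<open>The row sums use up \<open>a\<close>; what is left below
    \<open>sqrt (2 + \<epsilon>)\<close> has to absorb the norm and the recentring error, both of
    order at most \<open>sqrt n\<close>.\<close>
  define gap where "gap = (sqrt (2 + \<epsilon>) - a) * \<sigma>"
  have gap: "gap > 0" using pos \<sigma>_pos unfolding gap_def a_def by simp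
  have "(\<lambda>n. real n powr (2 - p / 3)) \<longlonglongrightarrow> 0"
    using p6 by (intro tendsto_neg_powr filterlim_real_sequentially) auto
  from tendsto_mult[OF this tendsto_const[of abs_moment]]
  have ev1: "\<forall>\<^sub>F n in sequentially. real n powr (2 - p / 3) * abs_moment < \<eta> / 3"
    using pos by (intro order_tendstoD(2)) auto
  have ev2: "\<forall>\<^sub>F n in sequentially. 1 / real n < \<eta> / 3"
    using pos lim_1_over_n by (intro order_tendstoD(2)) auto
  have "filterlim (\<lambda>n. sqrt (ln (real n))) at_top sequentially" by real_asymp
  then have ev3: "\<forall>\<^sub>F n in sequentially. (C + abs_moment) / gap \<le> sqrt (ln (real n))"
    unfolding filterlim_at_top by blast
  have "\<eta> / 3 > 0" using pos by simp
  note ev4 = eventually_row_sum_term_le[OF \<sigma>_pos pos(1) this, folded a_def]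
  show ?thesis
    using ev1 ev2 ev3 ev4 eventually_spectral_condition[OF \<sigma>_pos] eventually_ge_at_top[of 3]
  proof eventually_elim
    case (elim n)
    define T where "T = real n powr (1 / 3)"
    define s where "s = a * \<sigma> * sqrt (real n * ln (real n))"
    define t where "t = a * sqrt (ln (real n) / real n) / \<sigma>"
    have n: "n \<ge> 1" "real n \<ge> 1" "ln (real n) > 0" using elim by auto
    have T: "T > 0" using n unfolding T_def by simp
    have t: "t > 0" using a \<sigma>_pos n unfolding t_def by simp
    obtain l :: nat where l: "ln (real n) \<le> 2 ^ l" "2 ^ l \<le> 2 * ln (real n) + 1"
      using ex_power_of_two_between[of "ln (real n)"] n by auto
    define k :: nat where "k = 2 ^ l"
    have k: "ln (real n) \<le> real k" "real (2 * k) \<le> 4 * ln (real n) + 2" using l unfolding k_def by auto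
    have \<rho>: "real (2 * k) * (1 / real n + 2 * T / (\<sigma> * sqrt (real n))) * exp (1 / 32 * real (2 * k)) \<le> 1"
    proof -
      have "real (2 * k) * (1 / real n + 2 * T / (\<sigma> * sqrt (real n))) * exp (1 / 32 * real (2 * k))
          \<le> (4 * ln (real n) + 2) * (1 / real n + 2 * T / (\<sigma> * sqrt (real n))) *
            exp (1 / 32 * (4 * ln (real n) + 2))"
        using k(2) n T \<sigma>_pos by (intro mult_mono mult_nonneg_nonneg add_nonneg_nonneg) auto
      then show ?thesis using elim(5) unfolding T_def by linarith
    qed
    show ?case
    proof (intro allI impI)
      fix M :: "'a measure" and X
      assume W: "wigner_matrix n \<mu> M X"
      have "(0::real) < 1 / 32" by simp
      from lambda_max_laplacian_tail[OF W n(1) T t this k_def \<rho>, where s = s]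
      obtain E where E: "E \<in> sets M"
        and PE: "measure M E \<le> (real n)\<^sup>2 * (T powr (- p) * abs_moment)
          + real n * exp (real n * (t\<^sup>2 * \<sigma>\<^sup>2 / 2 * exp (t * (2 * T))) - t * s)
          + real n * exp (- 2 * real k)"
        and le: "\<And>\<omega>. \<omega> \<in> space M - E \<Longrightarrow> lambda_max (laplacian (X \<omega>))
          \<le> s + C * sqrt (real n) + real n * (T powr (1 - p) * abs_moment)"
        unfolding C_def by metis
      have eqT: "(real n)\<^sup>2 * (T powr (- p) * abs_moment) = real n powr (2 - p / 3) * abs_moment"
      proof -
        have "(real n)\<^sup>2 * T powr (- p) = real n powr 2 * real n powr (- (p / 3))"
          using n unfolding T_def powr_powr by simp
        also have "\<dots> = real n powr (2 - p / 3)" by (simp only: powr_add[symmetric]) simp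
        finally show ?thesis by (simp add: mult.assoc)
      qed
      have 1: "(real n)\<^sup>2 * (T powr (- p) * abs_moment) \<le> \<eta> / 3"
        using elim(1) unfolding eqT by simp
      have 2: "real n * exp (real n * (t\<^sup>2 * \<sigma>\<^sup>2 / 2 * exp (t * (2 * T))) - t * s) \<le> \<eta> / 3"
        using elim(4) unfolding t_def T_def s_def .
      have "real n * exp (- 2 * real k) \<le> real n * exp (- 2 * ln (real n))"
        using k by (intro mult_left_mono) auto
      also have "\<dots> = real n * (real n powr (- 2))" using n by (simp add: powr_def)
      also have "\<dots> = 1 / real n" using n by (simp add: powr_minus power2_eq_square field_simps)
      finally have 3: "real n * exp (- 2 * real k) \<le> \<eta> / 3" using elim(2) by linarith
      have PE': "measure M E \<le> \<eta>" using PE 1 2 3 by linarith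
      have "lambda_max (laplacian (X \<omega>)) \<le> sqrt (2 + \<epsilon>) * \<sigma> * sqrt (real n * ln (real n))"
        if \<omega>: "\<omega> \<in> space M - E" for \<omega>
      proof -
        have "real n * T powr (1 - p) = real n powr (1 + (1 - p) / 3)"
          using n unfolding T_def powr_powr by (simp add: powr_add)
        \<comment> \<open>The exponent \<open>1 + (1 - p) / 3\<close> is negative as soon as
          \<open>p > 4\<close>.\<close>
        also have "\<dots> \<le> real n powr 0"
          using n p6 by (intro powr_mono) (auto simp: field_simps)
        also have "\<dots> \<le> sqrt (real n)" using n by simp
        finally have "real n * T powr (1 - p) * abs_moment \<le> sqrt (real n) * abs_moment"
          using abs_moment_nonneg by (intro mult_right_mono)
        moreover have "(C + abs_moment) * sqrt (real n) \<le> gap * sqrt (ln (real n)) * sqrt (real n)"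
          using elim(3) gap by (intro mult_right_mono) (auto simp: field_simps)
        moreover have "gap * sqrt (ln (real n)) * sqrt (real n)
            = sqrt (2 + \<epsilon>) * \<sigma> * sqrt (real n * ln (real n)) - s"
          unfolding gap_def s_def real_sqrt_mult by (simp add: algebra_simps)
        ultimately show ?thesis using le[OF \<omega>] by (simp add: algebra_simps)
      qed
      with E PE' show "\<exists>E\<in>sets M. measure M E \<le> \<eta> \<and> (\<forall>\<omega>\<in>space M - E.
          lambda_max (laplacian (X \<omega>)) \<le> sqrt (2 + \<epsilon>) * \<sigma> * sqrt (real n * ln (real n)))"
        by blast
    qed
  qed
qed

theorem theorem3:
  fixes \<sigma> p c :: real
    and \<mu> :: "real measure"
    and M :: "nat \<Rightarrow> 'a measure"
    and X :: "nat \<Rightarrow> 'a \<Rightarrow> real mat"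
  assumes "\<sigma> > 0" and "p > 6"
    and "real_distribution \<mu>"
    and "integrable \<mu> (\<lambda>x. \<bar>x\<bar> powr p)"
    and "prob_space.expectation \<mu> (\<lambda>x. x) = 0"
    and "prob_space.variance \<mu> (\<lambda>x. x) = \<sigma>\<^sup>2"
    and "\<And>n. n \<ge> 2 \<Longrightarrow> wigner_matrix n \<mu> (M n) (X n)"
    and "c > 0"
    and "with_high_probability M (\<lambda>n \<omega>.
           \<sigma> * sqrt ((real n - 1) * ln (real n)) \<le> c * max_diag (laplacian (X n \<omega>)))"
  shows "\<forall>\<epsilon>>0. let K = c * sqrt (2 + \<epsilon>) in
           K > 0 \<and>
           with_high_probability M (\<lambda>n \<omega>.
             lambda_max (laplacian (X n \<omega>))
               \<le> K * (1 + 1 / sqrt (real n - 1)) * max_diag (laplacian (X n \<omega>)))"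
proof (intro allI impI)
  fix \<epsilon> :: real assume \<epsilon>: "\<epsilon> > 0"
  interpret \<mu>: real_distribution \<mu> by fact
  interpret \<mu>: centred_law \<mu> \<sigma> p
    by unfold_locales (use assms(1-6) in auto)
  define K where "K = c * sqrt (2 + \<epsilon>)"
  have K: "K > 0" using \<epsilon> \<open>c > 0\<close> unfolding K_def by simp
  have "with_high_probability M (\<lambda>n \<omega>. lambda_max (laplacian (X n \<omega>))
      \<le> K * (1 + 1 / sqrt (real n - 1)) * max_diag (laplacian (X n \<omega>)))"
    unfolding with_high_probability_def
  proof (intro allI impI)
    fix \<eta> :: real assume \<eta>: "\<eta> > 0"
    \<comment> \<open>One share of \<eta> for the hypothesis and one for the exceptional set. The
      cap 1/2 keeps \<open>1 - \<delta>\<close> positive.\<close>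
    define \<delta> where "\<delta> = min (\<eta> / 2) (1 / 2)"
    have \<delta>: "\<delta> > 0" "\<delta> \<le> \<eta> / 2" "\<delta> < 1" using \<eta> unfolding \<delta>_def by auto
    let ?H = "\<lambda>n. {\<omega> \<in> space (M n). \<sigma> * sqrt ((real n - 1) * ln (real n)) \<le> c * max_diag (laplacian (X n \<omega>))}"
    let ?G = "\<lambda>n. {\<omega> \<in> space (M n). lambda_max (laplacian (X n \<omega>))
        \<le> K * (1 + 1 / sqrt (real n - 1)) * max_diag (laplacian (X n \<omega>))}"
    obtain n1 where n1: "\<And>n. n > n1 \<Longrightarrow> measure (M n) (?H n) \<ge> 1 - \<delta>"
      using assms(9) \<delta>(1) unfolding with_high_probability_def by blast
    obtain n2 where n2: "\<And>n (M :: 'a measure) X. n \<ge> n2 \<Longrightarrow> wigner_matrix n \<mu> M X \<Longrightarrow>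
        \<exists>E\<in>sets M. measure M E \<le> \<delta> \<and> (\<forall>\<omega>\<in>space M - E.
          lambda_max (laplacian (X \<omega>)) \<le> sqrt (2 + \<epsilon>) * \<sigma> * sqrt (real n * ln (real n)))"
      using \<mu>.lambda_max_laplacian_whp[OF assms(2) \<epsilon> \<delta>(1), where 'a = 'a]
      unfolding eventually_sequentially by blast
    show "\<exists>n0. \<forall>n>n0. measure (M n) (?G n) \<ge> 1 - \<eta>"
    proof (intro exI allI impI)
      fix n assume "n > max 2 (max n1 n2)"
      then have n: "n > 2" "n > n1" "n \<ge> n2" by auto
      have W: "wigner_matrix n \<mu> (M n) (X n)" using assms(7) n(1) by simp
      interpret Mn: prob_space "M n" by (rule wigner_matrixD(1)[OF W])
      have H: "measure (M n) (?H n) \<ge> 1 - \<delta>" by (rule n1[OF n(2)])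
      \<comment> \<open>The hypothesis does not state measurability, but a set of nonzero measure
        must be an event.\<close>
      then have "measure (M n) (?H n) \<noteq> 0" using \<delta> by linarith
      then have Hm: "?H n \<in> sets (M n)" using measure_notin_sets by blast
      obtain E where E: "E \<in> sets (M n)" "measure (M n) E \<le> \<delta>"
        and le: "\<And>\<omega>. \<omega> \<in> space (M n) - E \<Longrightarrow>
          lambda_max (laplacian (X n \<omega>)) \<le> sqrt (2 + \<epsilon>) * \<sigma> * sqrt (real n * ln (real n))"
        using n2[OF n(3) W] by blast
      have G: "?G n \<in> sets (M n)" using lambda_max_laplacian_event[OF W] n(1) by simp
      have "?H n - E \<subseteq> ?G n"
      proof
        fix \<omega> assume \<omega>: "\<omega> \<in> ?H n - E"
        define r where "r = sqrt (real n - 1)"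
        have r: "r > 0" using n(1) unfolding r_def by simp
        have "sqrt (real n) \<le> r + 1"
          using sqrt_add_le_add_sqrt[of "real n - 1" 1] n(1) unfolding r_def by simp
        also have "\<dots> = (1 + 1 / r) * r" using r by (simp add: field_simps)
        finally have sq: "sqrt (real n) \<le> (1 + 1 / r) * r" .
        have "lambda_max (laplacian (X n \<omega>)) \<le> sqrt (2 + \<epsilon>) * \<sigma> * (sqrt (real n) * sqrt (ln (real n)))"
          using le[of \<omega>] \<omega> by (simp add: real_sqrt_mult)
        also have "\<dots> \<le> sqrt (2 + \<epsilon>) * \<sigma> * ((1 + 1 / r) * r * sqrt (ln (real n)))"
          using sq \<epsilon> assms(1) n(1) by (intro mult_left_mono mult_right_mono) auto
        also have "\<dots> = sqrt (2 + \<epsilon>) * (1 + 1 / r) * (\<sigma> * sqrt ((real n - 1) * ln (real n)))"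
          unfolding r_def real_sqrt_mult by (simp add: mult_ac)
        also have "\<dots> \<le> sqrt (2 + \<epsilon>) * (1 + 1 / r) * (c * max_diag (laplacian (X n \<omega>)))"
          using \<omega> \<epsilon> r by (intro mult_left_mono) auto
        finally show "\<omega> \<in> ?G n" using \<omega> unfolding r_def K_def by (simp add: mult_ac)
      qed
      then have "?H n \<subseteq> ?G n \<union> E" by blast
      then have "measure (M n) (?H n) \<le> measure (M n) (?G n \<union> E)"
        using G E by (intro Mn.finite_measure_mono) auto
      also have "\<dots> \<le> measure (M n) (?G n) + measure (M n) E"
        using G E by (intro measure_Un_le)
      finally show "measure (M n) (?G n) \<ge> 1 - \<eta>" using H E(2) \<delta> by linarith
    qed
  qed
  with K show "let K = c * sqrt (2 + \<epsilon>) in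
           K > 0 \<and>
           with_high_probability M (\<lambda>n \<omega>.
             lambda_max (laplacian (X n \<omega>))
               \<le> K * (1 + 1 / sqrt (real n - 1)) * max_diag (laplacian (X n \<omega>)))"
    unfolding Let_def K_def by blast
qed

end
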